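(* Let $(g,c,n)$ be a v-admissible triplet of integers with $5\le g\le c\le n$. (i) If $2g-2\le c<3g-4$ and $c=2g-2+s$ with $0\le s\le g-3$, then $g/4\le A(g,c,n)\le (g+2+s)/4$. (ii) If $r$ is a positive integer, $g$ is even and $c=2g-2+r(g-2)$, then $g/4\le A(g,c,n)\le (g+2)/4$. (iii) If $r$ is a positive integer, $g$ is odd and $2g-2+r(g-2)\le c\le 2g-1+r(g-2)$, then $g/4\le A(g,c,n)\le (g+3)/4$. (iv) If $r,s$ are integers with $r\ge1$, $s\ge0$, $g$ is even and $2g-2+r(g-2)<c\le 2g-2+r(g-2)+2(r+1)(s+1)$, then $g/4\le A(g,c,n)\le (g+4+2s)/4$. (v) If $r,s$ are integers with $r\ge1$, $s\ge0$, $g$ is odd and $2g-1+r(g-2)<c\le 2g-2+r(g-2)+2(r+1)(s+1)$, then $g/4\le A(g,c,n)\le (g+5+2s)/4$.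
   Context: All graphs are finite, simple and connected. A graph $G$ is regarded as a geodesic metric space by identifying each edge isometrically with $[0,1]$; points are vertices and interior points of edges, $d$ is the shortest-path length. A geodesic triangle $T=\{x,y,z\}$ is a union of three geodesics $[xy],[yz],[zx]$; $\delta(T)$ is the infimum of $\delta\ge0$ such that each side lies in the $\delta$-neighbourhood of the union of the other two; $\delta(G)=\sup_T\delta(T)$ over geodesic triangles. Girth $g(G)$ / circumference $c(G)$: length of a shortest / longest cycle. $\mathcal{G}(g,c,n)$ is the set of graphs with girth $g$, circumference $c$ and $n$ vertices, and $A(g,c,n)=\min\{\delta(G):G\in\mathcal{G}(g,c,n)\}$. A triplet $(g,c,n)$ is v-admissible if $\mathcal{G}(g,c,n)\ne\emptyset$. *)

theory Defs
  imports Complex_Main "HOL-Library.Extended_Nat" "Graph_Theory.Graph_Theory"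
begin

text \<open>
  A finite simple connected graph is a \<^const>\<open>pair_graph\<close> (finite, symmetric, loop-free set of
  arcs) that is connected; an undirected edge is a pair of opposite arcs.
\<close>

section \<open>The geodesic metric space of a graph\<close>

text \<open>
  A point of the space is given by its barycentric coordinates:
  \<open>edge_point u v t\<close> is the point at distance \<open>t\<close> from \<open>u\<close> on the edge \<open>uv\<close>. Thus
  \<open>edge_point u v t = edge_point v u (1 - t)\<close>, and
  \<open>edge_point u v 0 = vertex_point u\<close> for every edge \<open>uv\<close> at \<open>u\<close>, so points of different edges
  are identified exactly as they should be.
\<close>

type_synonym 'a point = "'a \<Rightarrow> real"

definition vertex_point :: "'a \<Rightarrow> 'a point" where
  "vertex_point u = (\<lambda>w. of_bool (w = u))"

definition edge_point :: "'a \<Rightarrow> 'a \<Rightarrow> real \<Rightarrow> 'a point" where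
  "edge_point u v t = (\<lambda>w. (1 - t) * vertex_point u w + t * vertex_point v w)"

lemma edge_point_flip: "edge_point u v t = edge_point v u (1 - t)"
  by (simp add: edge_point_def fun_eq_iff)

lemma edge_point_ends [simp]:
  "edge_point u v 0 = vertex_point u" "edge_point u v 1 = vertex_point v"
  by (simp_all add: edge_point_def fun_eq_iff)

lemma edge_point_eq_iff:
  assumes "u \<noteq> v" "0 < t" "t < 1" "u' \<noteq> v'"
  shows "edge_point u v t = edge_point u' v' t' \<longleftrightarrow>
    (u' = u \<and> v' = v \<and> t' = t) \<or> (u' = v \<and> v' = u \<and> t' = 1 - t)"
proof
  assume eq: "edge_point u v t = edge_point u' v' t'"
  have "edge_point u v t w = edge_point u' v' t' w" for w
    using eq by simp
  note ev = this[unfolded edge_point_def vertex_point_def]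
  show "(u' = u \<and> v' = v \<and> t' = t) \<or> (u' = v \<and> v' = u \<and> t' = 1 - t)"
    using ev[of u] ev[of v] assms
    by (cases "u' = u"; cases "v' = v"; cases "u' = v"; cases "v' = u") auto
next
  assume "(u' = u \<and> v' = v \<and> t' = t) \<or> (u' = v \<and> v' = u \<and> t' = 1 - t)"
  then show "edge_point u v t = edge_point u' v' t'"
    using edge_point_flip[of u v t] by auto
qed

definition points :: "'a pair_pre_digraph \<Rightarrow> 'a point set" where
  "points G = vertex_point ` pverts G \<union>
     {edge_point u v t | u v t. (u, v) \<in> parcs G \<and> 0 \<le> t \<and> t \<le> 1}"

text \<open>
  \<open>path_length G p q l\<close>: some path from \<open>p\<close> to \<open>q\<close>, made of finitely many segments each lying
  in a single edge, has length \<open>l\<close>.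
\<close>

inductive path_length :: "'a pair_pre_digraph \<Rightarrow> 'a point \<Rightarrow> 'a point \<Rightarrow> real \<Rightarrow> bool"
  for G :: "'a pair_pre_digraph" and p :: "'a point" where
  refl: "p \<in> points G \<Longrightarrow> path_length G p p 0"
| step: "path_length G p (edge_point u v s) l \<Longrightarrow> (u, v) \<in> parcs G \<Longrightarrow>
    s \<in> {0..1} \<Longrightarrow> t \<in> {0..1} \<Longrightarrow> path_length G p (edge_point u v t) (l + \<bar>s - t\<bar>)"

definition gdist :: "'a pair_pre_digraph \<Rightarrow> 'a point \<Rightarrow> 'a point \<Rightarrow> real" where
  "gdist G p q = Inf {l. path_length G p q l}"

section \<open>Hyperbolicity constant\<close>

definition is_geodesic :: "'a pair_pre_digraph \<Rightarrow> 'a point \<Rightarrow> 'a point \<Rightarrow> 'a point set \<Rightarrow> bool" where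
  "is_geodesic G x y S \<longleftrightarrow>
    (\<exists>\<gamma>. \<gamma> \<in> {0..gdist G x y} \<rightarrow> points G \<and> \<gamma> 0 = x \<and> \<gamma> (gdist G x y) = y \<and>
      (\<forall>s\<in>{0..gdist G x y}. \<forall>t\<in>{0..gdist G x y}. gdist G (\<gamma> s) (\<gamma> t) = \<bar>s - t\<bar>) \<and>
      S = \<gamma> ` {0..gdist G x y})"

definition neighbourhood :: "'a pair_pre_digraph \<Rightarrow> real \<Rightarrow> 'a point set \<Rightarrow> 'a point set" where
  "neighbourhood G \<delta> S = {p \<in> points G. \<exists>q\<in>S. gdist G p q \<le> \<delta>}"

definition triangle_delta ::
    "'a pair_pre_digraph \<Rightarrow> 'a point set \<Rightarrow> 'a point set \<Rightarrow> 'a point set \<Rightarrow> real" where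
  "triangle_delta G S\<^sub>1 S\<^sub>2 S\<^sub>3 = Inf {\<delta>. 0 \<le> \<delta> \<and>
     S\<^sub>1 \<subseteq> neighbourhood G \<delta> (S\<^sub>2 \<union> S\<^sub>3) \<and>
     S\<^sub>2 \<subseteq> neighbourhood G \<delta> (S\<^sub>3 \<union> S\<^sub>1) \<and>
     S\<^sub>3 \<subseteq> neighbourhood G \<delta> (S\<^sub>1 \<union> S\<^sub>2)}"

text \<open>For a finite connected graph the supremum is over a set bounded by the diameter.\<close>

definition hyperbolicity :: "'a pair_pre_digraph \<Rightarrow> real" where
  "hyperbolicity G = Sup {triangle_delta G S\<^sub>1 S\<^sub>2 S\<^sub>3 | x y z S\<^sub>1 S\<^sub>2 S\<^sub>3.
     x \<in> points G \<and> y \<in> points G \<and> z \<in> points G \<and>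
     is_geodesic G x y S\<^sub>1 \<and> is_geodesic G y z S\<^sub>2 \<and> is_geodesic G z x S\<^sub>3}"

section \<open>Girth and circumference\<close>

text \<open>
  The library's cycles in a symmetric digraph include the closed walks \<open>u, v, u\<close> of length 2,
  which are not cycles of the simple graph. An acyclic graph gets girth \<open>\<infinity>\<close> and circumference 0.
\<close>

definition cycle_lengths :: "'a pair_pre_digraph \<Rightarrow> nat set" where
  "cycle_lengths G = {length p | p. pre_digraph.cycle (with_proj G) p \<and> 3 \<le> length p}"

definition girth :: "'a pair_pre_digraph \<Rightarrow> enat" where
  "girth G = Inf (enat ` cycle_lengths G)"

definition circumference :: "'a pair_pre_digraph \<Rightarrow> enat" where
  "circumference G = Sup (enat ` cycle_lengths G)"

section \<open>The extremal problem\<close>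

text \<open>
  Every graph with \<open>n\<close> vertices is isomorphic to one with vertex set \<open>{..<n}\<close>; fixing that
  vertex set makes the class of graphs a finite set, so that the minimum is taken over a finite
  set of reals.
\<close>

definition graph_class :: "nat \<Rightarrow> nat \<Rightarrow> nat \<Rightarrow> nat pair_pre_digraph set" where
  "graph_class g c n = {G. pair_graph G \<and> Digraph_Component.connected (with_proj G) \<and>
     pverts G = {..<n} \<and> girth G = enat g \<and> circumference G = enat c}"

definition v_admissible :: "nat \<Rightarrow> nat \<Rightarrow> nat \<Rightarrow> bool" where
  "v_admissible g c n \<longleftrightarrow> graph_class g c n \<noteq> {}"

definition min_hyperbolicity :: "nat \<Rightarrow> nat \<Rightarrow> nat \<Rightarrow> real" where
  "min_hyperbolicity g c n = Min (hyperbolicity ` graph_class g c n)"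

lemma finite_graph_class: "finite (graph_class g c n)"
proof -
  have "graph_class g c n \<subseteq>
      (\<lambda>E. \<lparr>pverts = {..<n}, parcs = E\<rparr>) ` Pow ({..<n} \<times> {..<n})"
  proof
    fix G assume G: "G \<in> graph_class g c n"
    then interpret pair_graph G by (simp add: graph_class_def)
    have "parcs G \<subseteq> {..<n} \<times> {..<n}"
      using G in_arcsD1 in_arcsD2 by (auto simp: graph_class_def)
    moreover have "G = \<lparr>pverts = {..<n}, parcs = parcs G\<rparr>"
      using G by (cases G) (simp add: graph_class_def)
    ultimately show "G \<in> (\<lambda>E. \<lparr>pverts = {..<n}, parcs = E\<rparr>) ` Pow ({..<n} \<times> {..<n})"
      by blast
  qed
  then show ?thesis
    by (rule finite_subset) simp
qed

end

theory Submission
  imports Defs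
begin

text \<open>
  Lower bound: a shortest cycle is isometric, so a geodesic bigon made of its two halves has a
  point of one half at distance \<open>g / 4\<close> from the other half.

  Upper bound: a graph with the prescribed girth, circumference and order is a chain of cycles
  (cells), each glued to the next along an edge and with the two glued edges of an inner cell as
  opposite as possible, plus a tail that supplies the missing vertices. The glued edges and the
  vertices of the tail are gates: each separates the graph. If \<open>p\<close> lies on a geodesic from \<open>x\<close> to
  \<open>y\<close>, the other two sides of a triangle form a connected set with the same ends and so pass every
  gate between \<open>x\<close> and \<open>y\<close>. The geodesic is short inside the cell of \<open>p\<close>, the gates have diameter
  at most 1, and hence one of the two gates (or ends) around \<open>p\<close> is close enough.
\<close>

section \<open>Paths, distances and 1-Lipschitz functions\<close>

text \<open>A cell of length L has diameter at most L/2. If one gate of diameter 1 is involved, the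
  two ways from \<open>p\<close> to the rest of the triangle add up to at most L/2 + 1, so the
  shorter one is at most (L + 2)/4. Two such gates would give only (L + 4)/4. A geodesic that
  crosses an inner cell from chord to chord is therefore treated differently: a point on a side of
  length y is within y/2 + 1 of every point of one of the chords. The sides have lengths (L - 2) div
  2 and (L - 1) div 2, so this is at most (L + 2)/4 for even L and (L + 3)/4 for odd L; hence the
  parity cases. The five bounds are these values at L = g + B, where the largest surplus B of a cell
  over the girth is s, 0, 1, 2s + 2 and 2s + 2. In (i) there are only two cells, hence no inner one
  and no parity case. Gates are encoded as zero sets of 1-Lipschitz functions on the vertices,
  extended linearly to the edges. Separation becomes a change of sign, and the intermediate value
  theorem replaces arguments about connected components.\<close>

lemma edge_point_eq_vertex_point:
  assumes "u \<noteq> v" "edge_point u v t = vertex_point w"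
  shows "t = 0 \<and> w = u \<or> t = 1 \<and> w = v"
proof -
  have "edge_point u v t x = vertex_point w x" for x using assms(2) by simp
  from this[of u] this[of v] show ?thesis using assms(1)
    by (cases "w = u"; cases "w = v") (simp_all add: edge_point_def vertex_point_def)
qed

text \<open>Elementary form of a finite simple connected graph, with connectedness as reachability
  along arcs; \<open>conn_graph_iff\<close> identifies it with the notion used in
  \<open>graph_class\<close>.\<close>

locale conn_graph =
  fixes G :: "'a pair_pre_digraph"
  assumes finite_verts: "finite (pverts G)"
    and verts_nonempty: "pverts G \<noteq> {}"
    and arcs_verts: "(u, v) \<in> parcs G \<Longrightarrow> u \<in> pverts G \<and> v \<in> pverts G"
    and arcs_sym: "(u, v) \<in> parcs G \<Longrightarrow> (v, u) \<in> parcs G"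
    and arcs_irrefl: "(u, v) \<in> parcs G \<Longrightarrow> u \<noteq> v"
    and verts_linked: "u \<in> pverts G \<Longrightarrow> v \<in> pverts G \<Longrightarrow> (u, v) \<in> (parcs G)\<^sup>*"
begin

abbreviation dist where "dist \<equiv> gdist G"

lemma vertex_in_points: "u \<in> pverts G \<Longrightarrow> vertex_point u \<in> points G"
  by (simp add: points_def)

lemma edge_in_points: "(u, v) \<in> parcs G \<Longrightarrow> 0 \<le> t \<Longrightarrow> t \<le> 1 \<Longrightarrow> edge_point u v t \<in> points G"
  by (auto simp: points_def)

lemma points_cases:
  assumes "p \<in> points G"
  obtains (vertex) u where "u \<in> pverts G" "p = vertex_point u"
  | (edge) u v t where "(u, v) \<in> parcs G" "0 < t" "t < 1" "p = edge_point u v t"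
proof -
  from assms consider u where "u \<in> pverts G" "p = vertex_point u"
    | u v t where "(u, v) \<in> parcs G" "0 \<le> t" "t \<le> 1" "p = edge_point u v t"
    by (auto simp: points_def)
  then show thesis
  proof cases
    case (2 u v t)
    then show ?thesis
      using vertex[of u] vertex[of v] edge[of u v t] arcs_verts[of u v]
      by (cases "t = 0"; cases "t = 1") auto
  qed (rule vertex)
qed

lemma path_length_points:
  "path_length G p q l \<Longrightarrow> p \<in> points G \<and> q \<in> points G \<and> 0 \<le> l"
  by (induction rule: path_length.induct) (auto intro: edge_in_points)

lemma path_length_trans:
  assumes "path_length G q r l'" "path_length G p q l"
  shows "path_length G p r (l + l')"
  using assms(1)
proof (induction rule: path_length.induct)
  case refl
  then show ?case using assms(2) by simp
next
  case (step u v s l' t)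
  from path_length.step[OF step.IH step.hyps(2-4)] show ?case by (simp add: add.assoc)
qed

lemma path_length_edge:
  assumes "(u, v) \<in> parcs G" "s \<in> {0..1}" "t \<in> {0..1}"
  shows "path_length G (edge_point u v s) (edge_point u v t) \<bar>s - t\<bar>"
  using path_length.step[OF path_length.refl assms] edge_in_points[of u v s] assms by auto

lemma path_length_sym:
  assumes "path_length G p q l"
  shows "path_length G q p l"
  using assms
proof (induction rule: path_length.induct)
  case refl
  then show ?case by (rule path_length.refl)
next
  case (step u v s l t)
  from path_length_trans[OF step.IH path_length_edge[OF step.hyps(2) step.hyps(4) step.hyps(3)]]
  show ?case by (simp add: add.commute abs_minus_commute)
qed

lemma path_length_arc:
  "(u, v) \<in> parcs G \<Longrightarrow> path_length G (vertex_point u) (vertex_point v) 1"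
  using path_length_edge[of u v 0 1] by simp

lemma path_length_vertices:
  assumes "u \<in> pverts G" "v \<in> pverts G"
  shows "\<exists>l. path_length G (vertex_point u) (vertex_point v) l"
  using verts_linked[OF assms]
proof (induction rule: rtrancl_induct)
  case base
  then show ?case using path_length.refl[OF vertex_in_points[OF assms(1)]] by blast
next
  case (step v w)
  then show ?case using path_length_trans[OF path_length_arc] by blast
qed

lemma path_length_to_vertex:
  assumes "p \<in> points G"
  shows "\<exists>u l. u \<in> pverts G \<and> path_length G p (vertex_point u) l"
  using assms
proof (cases rule: points_cases)
  case (vertex u)
  then show ?thesis using path_length.refl[OF assms] by auto
next
  case (edge u v t)
  then show ?thesis using path_length_edge[of u v t 0] arcs_verts[of u v] by auto
qed

lemma path_length_exists:
  assumes "p \<in> points G" "q \<in> points G"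
  shows "\<exists>l. path_length G p q l"
proof -
  obtain u l v m where "u \<in> pverts G" "path_length G p (vertex_point u) l"
    "v \<in> pverts G" "path_length G q (vertex_point v) m"
    using path_length_to_vertex assms by metis
  then show ?thesis
    using path_length_vertices[of u v] path_length_trans path_length_sym by meson
qed

lemma path_lengths_bdd_below: "bdd_below {l. path_length G p q l}"
  using path_length_points by (intro bdd_belowI[of _ 0]) auto

lemma dist_le: "path_length G p q l \<Longrightarrow> dist p q \<le> l"
  unfolding gdist_def by (rule cInf_lower[OF _ path_lengths_bdd_below]) simp

lemma dist_greatest:
  assumes "p \<in> points G" "q \<in> points G" "\<And>l. path_length G p q l \<Longrightarrow> c \<le> l"
  shows "c \<le> dist p q"
  unfolding gdist_def using path_length_exists[OF assms(1,2)] assms(3)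
  by (intro cInf_greatest) auto

lemma dist_approx:
  assumes "p \<in> points G" "q \<in> points G" "0 < e"
  obtains l where "path_length G p q l" "l < dist p q + e"
proof -
  have "\<not> (\<forall>l. path_length G p q l \<longrightarrow> dist p q + e \<le> l)"
    using dist_greatest[OF assms(1,2), of "dist p q + e"] assms(3) by auto
  then show thesis using that by (auto simp: not_le)
qed

lemma dist_nonneg: "p \<in> points G \<Longrightarrow> q \<in> points G \<Longrightarrow> 0 \<le> dist p q"
  by (rule dist_greatest) (auto dest: path_length_points)

lemma dist_self: "p \<in> points G \<Longrightarrow> dist p p = 0"
  using dist_le[OF path_length.refl, of p] dist_nonneg[of p p] by simp

lemma dist_sym: "dist p q = dist q p"
proof -
  have "path_length G p q l \<longleftrightarrow> path_length G q p l" for l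
    by (meson path_length_sym)
  then show ?thesis by (simp add: gdist_def)
qed

lemma dist_triangle:
  assumes "p \<in> points G" "q \<in> points G" "r \<in> points G"
  shows "dist p r \<le> dist p q + dist q r"
proof (rule field_le_epsilon)
  fix e :: real assume "0 < e"
  then have e2: "0 < e / 2" by simp
  obtain l where l: "path_length G p q l" "l < dist p q + e / 2"
    using dist_approx[OF assms(1,2) e2] .
  obtain m where m: "path_length G q r m" "m < dist q r + e / 2"
    using dist_approx[OF assms(2,3) e2] .
  show "dist p r \<le> dist p q + dist q r + e"
    using dist_le[OF path_length_trans[OF m(1) l(1)]] l m by simp
qed

lemma dist_edge_le:
  "(u, v) \<in> parcs G \<Longrightarrow> s \<in> {0..1} \<Longrightarrow> t \<in> {0..1} \<Longrightarrow>
    dist (edge_point u v s) (edge_point u v t) \<le> \<bar>s - t\<bar>"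
  by (rule dist_le[OF path_length_edge])

text \<open>Since points are barycentric coordinates, this sum is the extension of \<open>f\<close>
  that is affine on every edge. Distances are infima over paths, so lower bounds for them come from
  such functions: a 1-Lipschitz one changes by at most the length of a path.\<close>

definition lin_ext :: "('a \<Rightarrow> real) \<Rightarrow> 'a point \<Rightarrow> real" where
  "lin_ext f p = (\<Sum>w\<in>pverts G. p w * f w)"

definition lipschitz1 :: "('a \<Rightarrow> real) \<Rightarrow> bool" where
  "lipschitz1 f \<longleftrightarrow> (\<forall>(u, v)\<in>parcs G. \<bar>f u - f v\<bar> \<le> 1)"

lemma lin_ext_vertex: "u \<in> pverts G \<Longrightarrow> lin_ext f (vertex_point u) = f u"
proof -
  assume u: "u \<in> pverts G"
  have "lin_ext f (vertex_point u) = (\<Sum>w\<in>pverts G. if w = u then f w else 0)"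
    unfolding lin_ext_def by (rule sum.cong) (auto simp: vertex_point_def)
  then show ?thesis using u finite_verts by simp
qed

lemma lin_ext_edge:
  assumes "(u, v) \<in> parcs G"
  shows "lin_ext f (edge_point u v t) = (1 - t) * f u + t * f v"
proof -
  have "lin_ext f (edge_point u v t) =
      (1 - t) * lin_ext f (vertex_point u) + t * lin_ext f (vertex_point v)"
    unfolding lin_ext_def edge_point_def sum_distrib_left sum.distrib[symmetric]
    by (rule sum.cong) (auto simp: algebra_simps)
  then show ?thesis using lin_ext_vertex arcs_verts[OF assms] by simp
qed

lemma lin_ext_path:
  assumes "lipschitz1 f" "path_length G p q l"
  shows "\<bar>lin_ext f q - lin_ext f p\<bar> \<le> l"
  using assms(2)
proof (induction rule: path_length.induct)
  case refl
  then show ?case by simp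
next
  case (step u v s l t)
  have "lin_ext f (edge_point u v t) - lin_ext f (edge_point u v s) = (s - t) * (f u - f v)"
    using step.hyps(2) by (simp add: lin_ext_edge algebra_simps)
  moreover have "\<bar>f u - f v\<bar> \<le> 1" using assms(1) step.hyps(2) by (auto simp: lipschitz1_def)
  ultimately have "\<bar>lin_ext f (edge_point u v t) - lin_ext f (edge_point u v s)\<bar> \<le> \<bar>s - t\<bar>"
    by (simp add: abs_mult mult_left_le)
  then show ?case using step.IH by linarith
qed

lemma lin_ext_lipschitz:
  assumes "lipschitz1 f" "p \<in> points G" "q \<in> points G"
  shows "\<bar>lin_ext f q - lin_ext f p\<bar> \<le> dist p q"
  by (rule dist_greatest[OF assms(2,3) lin_ext_path[OF assms(1)]])

text \<open>Each barycentric coordinate is the linear extension of an indicator function, which is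
  1-Lipschitz; distance 0 thus forces all coordinates to agree.\<close>

lemma dist_eq_0:
  assumes "p \<in> points G" "q \<in> points G" "dist p q \<le> 0"
  shows "p = q"
proof
  fix w
  show "p w = q w"
  proof (cases "w \<in> pverts G")
    case True
    let ?f = "\<lambda>x. if x = w then 1 else 0 :: real"
    have coord: "lin_ext ?f r = r w" for r
    proof -
      have "lin_ext ?f r = (\<Sum>x\<in>pverts G. if x = w then r x else 0)"
        unfolding lin_ext_def by (rule sum.cong) auto
      then show ?thesis using True finite_verts by simp
    qed
    have "lipschitz1 ?f" by (auto simp: lipschitz1_def)
    from lin_ext_lipschitz[OF this assms(1,2)] assms(3) show ?thesis
      by (simp add: coord)
  next
    case False
    have "r w = 0" if "r \<in> points G" for r
      using that
    proof (cases rule: points_cases)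
      case (vertex u)
      then show ?thesis using False by (auto simp: vertex_point_def)
    next
      case (edge u v t)
      then show ?thesis using False arcs_verts[of u v]
        by (auto simp: edge_point_def vertex_point_def)
    qed
    from this[OF assms(1)] this[OF assms(2)] show ?thesis by simp
  qed
qed

text \<open>Reduces distances from an interior point of an edge to distances from its ends: a path
  that stays in the edge is measured by the parameters, any other one passes an end, and what
  follows is recorded only through \<open>dist\<close>.\<close>

lemma path_length_exit:
  assumes "path_length G p q l" "p = edge_point a b t" "(a, b) \<in> parcs G" "0 \<le> t" "t \<le> 1"
  shows "(\<exists>s\<in>{0..1}. q = edge_point a b s \<and> \<bar>t - s\<bar> \<le> l) \<or>
    t + dist (vertex_point a) q \<le> l \<or> 1 - t + dist (vertex_point b) q \<le> l"
  using assms
proof (induction rule: path_length.induct)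
  case refl
  then show ?case by auto
next
  case (step u v s l t')
  let ?q = "edge_point u v s" and ?r = "edge_point u v t'"
  have ab: "a \<in> pverts G" "b \<in> pverts G" "vertex_point a \<in> points G" "vertex_point b \<in> points G"
    using arcs_verts step.prems(2) vertex_in_points by auto
  have pts: "?q \<in> points G" "?r \<in> points G" using step.hyps edge_in_points by auto
  have qr: "dist ?q ?r \<le> \<bar>s - t'\<bar>" using step.hyps dist_edge_le by auto
  from step.IH[OF step.prems] consider
    (stay) s' where "s' \<in> {0..1}" "?q = edge_point a b s'" "\<bar>t - s'\<bar> \<le> l"
    | (left) "t + dist (vertex_point a) ?q \<le> l" | (right) "1 - t + dist (vertex_point b) ?q \<le> l"
    by blast
  then show ?case
  proof cases
    case left
    then show ?thesis using dist_triangle[of "vertex_point a" ?q ?r] ab pts qr by linarith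
  next
    case right
    then show ?thesis using dist_triangle[of "vertex_point b" ?q ?r] ab pts qr by linarith
  next
    case stay
    consider "s' = 0" | "s' = 1" | "0 < s'" "s' < 1" using stay(1) by force
    then show ?thesis
    proof cases
      case 1
      then have "dist (vertex_point a) ?r \<le> \<bar>s - t'\<bar>" using qr stay(2) by simp
      then show ?thesis using 1 stay(3) step.prems by auto
    next
      case 2
      then have "dist (vertex_point b) ?r \<le> \<bar>s - t'\<bar>" using qr stay(2) by simp
      then show ?thesis using 2 stay(3) step.prems by auto
    next
      case 3
      have "a \<noteq> b" "u \<noteq> v" using arcs_irrefl step by auto
      \<comment> \<open>An interior point determines its edge up to orientation, so the next segment
        lies in the same edge.\<close>
      with 3 stay(2) have "u = a \<and> v = b \<and> s = s' \<or> u = b \<and> v = a \<and> s = 1 - s'"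
        using edge_point_eq_iff[of a b s' u v s] by auto
      then show ?thesis
      proof
        assume "u = a \<and> v = b \<and> s = s'"
        then show ?thesis using stay(3) step.hyps by (intro disjI1 bexI[of _ t']) auto
      next
        assume "u = b \<and> v = a \<and> s = 1 - s'"
        then show ?thesis using stay(3) step.hyps edge_point_flip[of b a t']
          by (intro disjI1 bexI[of _ "1 - t'"]) auto
      qed
    qed
  qed
qed

lemma dist_exit:
  assumes "(a, b) \<in> parcs G" "0 \<le> t" "t \<le> 1" "q \<in> points G"
    and "\<And>s. s \<in> {0..1} \<Longrightarrow> q = edge_point a b s \<Longrightarrow> c \<le> \<bar>t - s\<bar>"
    and "c \<le> t + dist (vertex_point a) q" "c \<le> 1 - t + dist (vertex_point b) q"
  shows "c \<le> dist (edge_point a b t) q"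
proof (rule dist_greatest)
  fix l assume "path_length G (edge_point a b t) q l"
  from path_length_exit[OF this HOL.refl assms(1-3)] show "c \<le> l"
  proof (elim disjE bexE conjE)
    fix s :: real assume "s \<in> {0..1}" "q = edge_point a b s" "\<bar>t - s\<bar> \<le> l"
    with assms(5)[of s] show "c \<le> l" by linarith
  qed (use assms(6,7) in linarith)+
qed (use assms edge_in_points in auto)

lemma dist_vertex_exit:
  assumes "(a, b) \<in> parcs G" "0 \<le> t" "t \<le> 1" "w \<in> pverts G"
    and "c \<le> t + dist (vertex_point a) (vertex_point w)"
      "c \<le> 1 - t + dist (vertex_point b) (vertex_point w)"
  shows "c \<le> dist (edge_point a b t) (vertex_point w)"
proof (rule dist_exit[OF assms(1-3) vertex_in_points[OF assms(4)] _ assms(5,6)])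
  fix s :: real assume "s \<in> {0..1}" and eq: "vertex_point w = edge_point a b s"
  from edge_point_eq_vertex_point[OF arcs_irrefl[OF assms(1)] eq[symmetric]]
  show "c \<le> \<bar>t - s\<bar>"
    using assms(2,3,5,6) dist_self[OF vertex_in_points[OF assms(4)]] by auto
qed

text \<open>The number of steps of a shortest walk from \<open>u\<close> is 1-Lipschitz, so counting
  arcs also bounds the distance in the metric space from below.\<close>

lemma walk_bounds_dist:
  assumes "u \<in> pverts G" "v \<in> pverts G"
    and "\<And>m. (u, v) \<in> parcs G ^^ m \<Longrightarrow> n \<le> m"
  shows "real n \<le> dist (vertex_point u) (vertex_point v)"
proof -
  define F where "F w = (LEAST m. (u, w) \<in> parcs G ^^ m)" for w
  have ex: "\<exists>m. (u, w) \<in> parcs G ^^ m" if "w \<in> pverts G" for w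
    using verts_linked[OF assms(1) that] rtrancl_imp_relpow by metis
  have F: "(u, w) \<in> parcs G ^^ F w" if "w \<in> pverts G" for w
    unfolding F_def using ex[OF that] by (rule LeastI_ex)
  have le: "F w \<le> F x + 1" if "(x, w) \<in> parcs G" for x w
  proof -
    have "(u, w) \<in> parcs G ^^ Suc (F x)" using F[of x] that arcs_verts by auto
    then have "F w \<le> Suc (F x)" unfolding F_def[of w] by (rule Least_le)
    then show ?thesis by simp
  qed
  have "lipschitz1 (\<lambda>w. real (F w))"
    unfolding lipschitz1_def
  proof (clarify)
    fix x w assume "(x, w) \<in> parcs G"
    with le[of x w] le[of w x] arcs_sym show "\<bar>real (F x) - real (F w)\<bar> \<le> 1" by fastforce
  qed
  from lin_ext_lipschitz[OF this, of "vertex_point u" "vertex_point v"]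
  have "real (F v) - real (F u) \<le> dist (vertex_point u) (vertex_point v)"
    using assms by (simp add: vertex_in_points lin_ext_vertex)
  moreover have "F u = 0" unfolding F_def by (rule Least_equality) auto
  ultimately show ?thesis using assms(3)[OF F[OF assms(2)]] by linarith
qed

end

section \<open>Cycles\<close>

text \<open>An injective cyclic numbering of the vertices is easier to cut and to reverse than the
  arc lists behind \<open>cycle_lengths\<close>; \<open>cycle_lengths_iff\<close> connects the
  two.\<close>

definition is_cycle :: "'a pair_pre_digraph \<Rightarrow> (nat \<Rightarrow> 'a) \<Rightarrow> nat \<Rightarrow> bool" where
  "is_cycle G c k \<longleftrightarrow> 3 \<le> k \<and> inj_on c {..<k} \<and> (\<forall>i<k. (c i, c (Suc i mod k)) \<in> parcs G)"

lemma pcas_nth: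
  "pcas u p v \<Longrightarrow> Suc i < length p \<Longrightarrow> fst (p ! Suc i) = snd (p ! i)"
proof (induction p arbitrary: u i)
  case (Cons e p)
  show ?case
  proof (cases i)
    case 0
    then show ?thesis using Cons.prems by (cases p) auto
  next
    case (Suc j)
    then show ?thesis using Cons.IH[of "snd e" j] Cons.prems by auto
  qed
qed simp

lemma pcas_ends:
  "pcas u p v \<Longrightarrow> p \<noteq> [] \<Longrightarrow> fst (p ! 0) = u \<and> snd (p ! (length p - 1)) = v"
proof (induction p arbitrary: u)
  case (Cons e p)
  then show ?case by (cases p) auto
qed simp

lemma pcas_map:
  "pcas (h m) (map (\<lambda>i. (h i, h (Suc i))) [m..<m + n]) (h (m + n))"
proof (induction n arbitrary: m)
  case (Suc n)
  then show ?case using Suc[of "Suc m"] by (simp add: upt_conv_Cons del: upt_Suc)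
qed simp

lemma tl_pawalk_verts: "pcas u p v \<Longrightarrow> tl (pawalk_verts u p) = map snd p"
proof (induction p arbitrary: u)
  case (Cons e p)
  then have "pawalk_verts (snd e) p = snd e # map snd p" by (cases p) auto
  then show ?case by simp
qed simp

context conn_graph
begin

lemma cycle_conv:
  "pre_digraph.cycle (with_proj G) p \<longleftrightarrow>
    p \<noteq> [] \<and> set p \<subseteq> parcs G \<and> distinct (map snd p) \<and> (\<exists>u. pcas u p u)"
proof -
  have "u \<in> pverts G" if "p \<noteq> []" "set p \<subseteq> parcs G" "pcas u p u" for u
  proof (cases p)
    case (Cons e p')
    with that have "(u, snd e) \<in> parcs G" by (cases e) auto
    then show ?thesis using arcs_verts by blast
  qed (use that in simp)
  then show ?thesis
    unfolding pre_digraph.cycle_def pre_digraph.awalk_def cas_with_proj_eq awalk_verts_with_proj_eq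
    unfolding with_proj_simps using tl_pawalk_verts by fastforce
qed

lemma cycle_lengths_iff: "k \<in> cycle_lengths G \<longleftrightarrow> (\<exists>c. is_cycle G c k)"
proof
  assume "k \<in> cycle_lengths G"
  then obtain p u where p: "length p = k" "3 \<le> k" "set p \<subseteq> parcs G" "distinct (map snd p)" "pcas u p u"
    unfolding cycle_lengths_def cycle_conv by auto
  have "(snd (p ! i), snd (p ! (Suc i mod k))) \<in> parcs G" if "i < k" for i
  proof -
    have "snd (p ! i) = fst (p ! (Suc i mod k))"
    proof (cases "Suc i < k")
      case True
      then show ?thesis using pcas_nth[OF p(5)] p by auto
    next
      case False
      then have k: "k = Suc i" using that by simp
      then have "i = k - 1" "Suc i mod k = 0" by simp_all
      moreover have "p \<noteq> []" using p(1,2) by auto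
      ultimately show ?thesis using pcas_ends[OF p(5)] p(1) by simp
    qed
    moreover have "p ! (Suc i mod k) \<in> set p" using p(1,2) by (intro nth_mem) auto
    then have "p ! (Suc i mod k) \<in> parcs G" using p(3) by blast
    ultimately show ?thesis by simp
  qed
  moreover have "inj_on (\<lambda>i. snd (p ! i)) {..<k}"
    using p(1,4) by (auto simp: inj_on_def distinct_conv_nth)
  ultimately show "\<exists>c. is_cycle G c k" using p(2) unfolding is_cycle_def by blast
next
  assume "\<exists>c. is_cycle G c k"
  then obtain c where c: "3 \<le> k" "inj_on c {..<k}" "\<And>i. i < k \<Longrightarrow> (c i, c (Suc i mod k)) \<in> parcs G"
    unfolding is_cycle_def by blast
  let ?h = "\<lambda>i. c (i mod k)"
  let ?p = "map (\<lambda>i. (?h i, ?h (Suc i))) [0..<k]"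
  have "pcas (?h 0) ?p (?h k)" using pcas_map[of ?h 0 k] by simp
  then have "pcas (?h 0) ?p (?h 0)" by simp
  moreover have "set ?p \<subseteq> parcs G" using c(3) by auto
  moreover have "distinct (map snd ?p)"
  proof -
    have "inj_on (\<lambda>i. c (Suc i mod k)) {0..<k}"
    proof (rule inj_onI)
      fix i j assume ij: "i \<in> {0..<k}" "j \<in> {0..<k}" "c (Suc i mod k) = c (Suc j mod k)"
      then have "Suc i mod k = Suc j mod k" using c(1,2) by (auto dest: inj_onD)
      then show "i = j" using ij by (auto simp: mod_Suc split: if_splits)
    qed
    then show ?thesis by (simp add: distinct_map comp_def)
  qed
  ultimately have "pre_digraph.cycle (with_proj G) ?p" using c(1) unfolding cycle_conv by auto
  then show "k \<in> cycle_lengths G" unfolding cycle_lengths_def using c(1)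
    by (intro CollectI exI[of _ ?p]) auto
qed

lemma girth_eqD:
  assumes "girth G = enat g"
  shows "\<exists>c. is_cycle G c g" "is_cycle G c k \<Longrightarrow> g \<le> k"
proof -
  have ne: "enat ` cycle_lengths G \<noteq> {}"
    using assms unfolding girth_def by (auto simp: top_enat_def)
  then have "Inf (enat ` cycle_lengths G) \<in> enat ` cycle_lengths G"
    unfolding Inf_enat_def using LeastI_ex[of "\<lambda>x. x \<in> enat ` cycle_lengths G"] by auto
  then show "\<exists>c. is_cycle G c g" using assms cycle_lengths_iff by (auto simp: girth_def)
  show "g \<le> k" if "is_cycle G c k"
  proof -
    have "enat k \<in> enat ` cycle_lengths G" using that cycle_lengths_iff by blast
    then have "girth G \<le> enat k" unfolding girth_def by (rule Inf_lower)
    then show ?thesis using assms by simp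
  qed
qed

lemma girth_eqI:
  assumes "is_cycle G c g" "\<And>c k. is_cycle G c k \<Longrightarrow> g \<le> k"
  shows "girth G = enat g"
proof -
  have "g \<in> cycle_lengths G" "\<And>k. k \<in> cycle_lengths G \<Longrightarrow> g \<le> k"
    using assms unfolding cycle_lengths_iff by blast+
  then show ?thesis unfolding girth_def by (intro Inf_eqI) auto
qed

lemma circumference_eqI:
  assumes "is_cycle G c m" "\<And>c k. is_cycle G c k \<Longrightarrow> k \<le> m"
  shows "circumference G = enat m"
proof -
  have "m \<in> cycle_lengths G" "\<And>k. k \<in> cycle_lengths G \<Longrightarrow> k \<le> m"
    using assms unfolding cycle_lengths_iff by blast+
  then show ?thesis unfolding circumference_def by (intro Sup_eqI) auto
qed

text \<open>
  Two paths with common ends and different lengths part somewhere; the segments between that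
  vertex and the first vertex where they meet again form a cycle.
\<close>

lemma two_paths_cycle:
  fixes P Q :: "nat \<Rightarrow> 'a"
  assumes P: "inj_on P {..m}" "\<And>i. i < m \<Longrightarrow> (P i, P (Suc i)) \<in> parcs G"
    and Q: "inj_on Q {..n}" "\<And>i. i < n \<Longrightarrow> (Q i, Q (Suc i)) \<in> parcs G"
    and ends: "P 0 = Q 0" "P m = Q n" and "m \<noteq> n"
  shows "\<exists>c k. is_cycle G c k \<and> k \<le> m + n"
proof -
  define agree where "agree i \<longleftrightarrow> i \<le> m \<and> i \<le> n \<and> P i = Q i" for i
  \<comment> \<open>\<open>i\<close> is the end of the common initial segment of the two
    paths.\<close>
  define i where "i = (GREATEST i. agree i \<and> (\<forall>j\<le>i. agree j))"
  have g0: "agree 0 \<and> (\<forall>j\<le>0. agree j)" using ends by (simp add: agree_def)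
  have bnd: "\<And>j. agree j \<and> (\<forall>j'\<le>j. agree j') \<Longrightarrow> j \<le> m" by (simp add: agree_def)
  have "agree i \<and> (\<forall>j\<le>i. agree j)"
    unfolding i_def
    by (rule GreatestI_nat[of "\<lambda>i. agree i \<and> (\<forall>j\<le>i. agree j)" 0 m, OF g0 bnd])
  then have i: "agree i" "\<forall>j\<le>i. agree j" by simp_all
  have not_Suc: "\<not> agree (Suc i)"
  proof
    assume "agree (Suc i)"
    then have "agree (Suc i) \<and> (\<forall>j\<le>Suc i. agree j)" using i by (auto simp: le_Suc_eq)
    from Greatest_le_nat[of "\<lambda>i. agree i \<and> (\<forall>j\<le>i. agree j)" "Suc i" m, OF this bnd]
    show False by (simp add: i_def)
  qed
  have im: "i < m"
  proof (rule ccontr)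
    assume "\<not> i < m"
    then have "i = m" using i by (simp add: agree_def)
    then have "Q m = Q n" "m \<le> n" using i ends by (auto simp: agree_def)
    then show False using inj_onD[OF Q(1), of m n] \<open>m \<noteq> n\<close> by simp
  qed
  have i_n: "i < n"
  proof (rule ccontr)
    assume "\<not> i < n"
    then have "i = n" using i by (simp add: agree_def)
    then have "P m = P n" "n \<le> m" using i ends by (auto simp: agree_def)
    then show False using inj_onD[OF P(1), of m n] \<open>m \<noteq> n\<close> by simp
  qed
  have diff: "P (Suc i) \<noteq> Q (Suc i)" using not_Suc im i_n by (simp add: agree_def)
  define meets where "meets j \<longleftrightarrow> i < j \<and> j \<le> m \<and> P j \<in> Q ` {Suc i..n}" for j
  have m: "meets m" using im i_n ends by (auto simp: meets_def)
  \<comment> \<open>\<open>j\<close> is the first index after \<open>i\<close> at which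
    \<open>P\<close> meets the rest of \<open>Q\<close>, so the two segments share only their
    ends.\<close>
  define j where "j = (LEAST j. meets j)"
  have j: "meets j" unfolding j_def by (rule LeastI[of meets, OF m])
  have before: "\<not> meets j'" if "j' < j" for j' using not_less_Least that unfolding j_def by blast
  from j have "P j \<in> Q ` {Suc i..n}" by (simp add: meets_def)
  then obtain k where k: "i < k" "k \<le> n" "P j = Q k" by (auto simp: Suc_le_eq)
  have "i < j" "j \<le> m" using j by (auto simp: meets_def)
  then obtain a b where ab: "j = i + a" "k = i + b" "0 < a" "0 < b" "i + a \<le> m" "i + b \<le> n"
    using k by (metis less_imp_add_positive)
  \<comment> \<open>Forward \<open>a\<close> steps along \<open>P\<close> from the parting vertex,
    then back along \<open>Q\<close>.\<close>
  define c where "c x = (if x \<le> a then P (i + x) else Q (i + (a + b) - x))" for x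
  have "is_cycle G c (a + b)"
    unfolding is_cycle_def
  proof (intro conjI allI impI)
    \<comment> \<open>With a = b = 1 both paths would continue to the same vertex after
      \<open>i\<close>.\<close>
    have "\<not> (a = 1 \<and> b = 1)" using diff k ab by auto
    then show "3 \<le> a + b" using ab by linarith
    have PQ: "P (i + x) \<noteq> Q y" if "x \<le> a" "i < y" "y < i + b" for x y
    proof
      assume eq: "P (i + x) = Q y"
      consider "x = 0" | "0 < x" "x < a" | "x = a" using \<open>x \<le> a\<close> by linarith
      then show False
      proof cases
        case 1
        then have "Q i = Q y" using eq i by (simp add: agree_def)
        then show False using inj_onD[OF Q(1), of i y] that ab by simp
      next
        case 2
        then have "meets (i + x)" using eq that ab by (auto simp: meets_def)
        then show False using before[of "i + x"] 2 ab by simp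
      next
        case 3
        then have "Q (i + b) = Q y" using eq k ab by simp
        then show False using inj_onD[OF Q(1), of "i + b" y] that ab by simp
      qed
    qed
    show "inj_on c {..<a + b}"
    proof (rule linorder_inj_onI)
      fix x y assume xy: "x < y" "x \<in> {..<a + b}" "y \<in> {..<a + b}"
      consider "y \<le> a" | "x \<le> a" "a < y" | "a < x" using xy by linarith
      then show "c x \<noteq> c y"
      proof cases
        case 1
        then have "P (i + x) \<noteq> P (i + y)" using inj_onD[OF P(1), of "i + x" "i + y"] xy ab by auto
        then show ?thesis using 1 xy by (simp add: c_def)
      next
        case 2
        then have "P (i + x) \<noteq> Q (i + (a + b) - y)" using PQ[of x "i + (a + b) - y"] xy by simp
        then show ?thesis using 2 by (simp add: c_def)
      next
        case 3
        then have "Q (i + (a + b) - x) \<noteq> Q (i + (a + b) - y)"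
          using inj_on_eq_iff[OF Q(1), of "i + (a + b) - x" "i + (a + b) - y"] ab(5,6) xy by simp
        then show ?thesis using 3 xy by (simp add: c_def)
      qed
    qed auto
    fix x assume x: "x < a + b"
    consider "x < a" | y where "x = a + y" "Suc y < b" | "Suc x = a + b" "a \<le> x"
      using x by (metis Suc_lessI add_Suc_right le_Suc_ex nat_add_left_cancel_less not_less)
    then show "(c x, c (Suc x mod (a + b))) \<in> parcs G"
    proof cases
      case 1
      then show ?thesis using P(2)[of "i + x"] ab by (simp add: c_def)
    next
      case 2
      have "Q (Suc (i + b - Suc y)) = c x"
        using 2 ab k by (cases "y = 0") (auto simp: c_def Suc_diff_Suc)
      moreover have "c (Suc x mod (a + b)) = Q (i + b - Suc y)" using 2 by (simp add: c_def)
      moreover have "(Q (i + b - Suc y), Q (Suc (i + b - Suc y))) \<in> parcs G"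
        using 2 ab by (intro Q(2)) auto
      ultimately show ?thesis using arcs_sym by simp
    next
      case 3
      have "c x = Q (Suc i)"
      proof (cases "x \<le> a")
        case True
        then have "b = 1" "x = a" using 3 ab by linarith+
        then show ?thesis using k ab by (simp add: c_def)
      next
        case False
        have "i + (a + b) - x = Suc i" using 3 by linarith
        then show ?thesis using False by (simp add: c_def)
      qed
      moreover have "c (Suc x mod (a + b)) = Q i" using 3 i by (simp add: c_def agree_def)
      ultimately show ?thesis using arcs_sym[OF Q(2)[OF i_n]] by simp
    qed
  qed
  moreover have "a + b \<le> m + n" using ab by linarith
  ultimately show ?thesis by blast
qed

text \<open>A walk of least length repeats no vertex: cutting out the part between two visits would
  shorten it.\<close>

lemma shortest_walk_path:
  assumes "(u, v) \<in> parcs G ^^ m"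
  obtains P l where "l \<le> m" "P 0 = u" "P l = v" "inj_on P {..l}"
    "\<And>i. i < l \<Longrightarrow> (P i, P (Suc i)) \<in> parcs G"
proof -
  define l where "l = (LEAST l. (u, v) \<in> parcs G ^^ l)"
  have l: "(u, v) \<in> parcs G ^^ l" unfolding l_def using assms by (rule LeastI)
  have lm: "l' < l \<Longrightarrow> (u, v) \<notin> parcs G ^^ l'" for l' unfolding l_def by (rule not_less_Least)
  from l obtain P where P: "P 0 = u" "P l = v" "\<And>i. i < l \<Longrightarrow> (P i, P (Suc i)) \<in> parcs G"
    unfolding relpow_fun_conv by blast
  have seg: "(P a, P b) \<in> parcs G ^^ (b - a)" if "a \<le> b" "b \<le> l" for a b
    unfolding relpow_fun_conv using that P(3) by (intro exI[of _ "\<lambda>i. P (a + i)"]) auto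
  have "inj_on P {..l}"
  proof (rule linorder_inj_onI)
    fix a b assume ab: "a < b" "a \<in> {..l}" "b \<in> {..l}"
    show "P a \<noteq> P b"
    proof
      assume "P a = P b"
      then have "(P 0, P l) \<in> parcs G ^^ a O parcs G ^^ (l - b)"
        using seg[of 0 a] seg[of b l] ab by auto
      then have "(P 0, P l) \<in> parcs G ^^ (a + (l - b))" by (simp only: relpow_add)
      moreover have "a + (l - b) < l" using ab by auto
      ultimately show False using lm P(1,2) by simp
    qed
  qed auto
  moreover have "l \<le> m" unfolding l_def using assms by (rule Least_le)
  ultimately show thesis using that P by blast
qed

end

section \<open>Unit-speed curves through a sequence of vertices\<close>

definition curve :: "(int \<Rightarrow> 'a) \<Rightarrow> real \<Rightarrow> 'a point" where
  "curve f r = edge_point (f \<lfloor>r\<rfloor>) (f (\<lfloor>r\<rfloor> + 1)) (frac r)"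

lemma curve_of_int: "curve f (of_int i) = vertex_point (f i)"
  by (simp add: curve_def)

lemma curve_edge:
  assumes "0 \<le> s" "s \<le> 1"
  shows "curve f (of_int i + s) = edge_point (f i) (f (i + 1)) s"
proof (cases "s = 1")
  case True
  then show ?thesis using curve_of_int[of f "i + 1"] by simp
next
  case False
  then have "\<lfloor>of_int i + s\<rfloor> = i" using assms by (intro floor_unique) auto
  then show ?thesis by (simp add: curve_def frac_def)
qed

lemma curve_periodic:
  assumes "\<And>i. f (i + L) = f i"
  shows "curve f (r + of_int L) = curve f r"
  using assms[of "\<lfloor>r\<rfloor>"] assms[of "\<lfloor>r\<rfloor> + 1"]
  by (simp add: curve_def frac_def algebra_simps)

context conn_graph
begin

lemma curve_in_points: "(\<And>i. (f i, f (i + 1)) \<in> parcs G) \<Longrightarrow> curve f r \<in> points G"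
  unfolding curve_def by (intro edge_in_points) (auto simp: frac_ge_0 less_imp_le[OF frac_lt_1])

lemma curve_lipschitz:
  assumes arcs: "\<And>i. (f i, f (i + 1)) \<in> parcs G" and "r \<le> s"
  shows "dist (curve f r) (curve f s) \<le> s - r"
proof -
  \<comment> \<open>\<open>n\<close> bounds the number of unit edges from
    \<open>\<lfloor>r\<rfloor>\<close> to \<open>s\<close>; each induction step moves the starting
    parameter to the next integer \<open>m\<close>.\<close>
  have "dist (curve f r) (curve f s) \<le> s - r" if "r \<le> s" "s \<le> of_int \<lfloor>r\<rfloor> + real n" for n r s
    using that
  proof (induction n arbitrary: r s)
    case 0
    then have "r = s" by linarith
    then show ?case using dist_self[OF curve_in_points[of f, OF arcs]] by simp
  next
    case (Suc n)
    define z where "z = real_of_int \<lfloor>r\<rfloor>"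
    define m where "m = z + 1"
    have z: "z \<le> r" "r < m" unfolding z_def m_def by linarith+
    have edge: "dist (curve f r) (curve f x) \<le> x - r" if "r \<le> x" "x \<le> m" for x
    proof -
      have pt: "curve f y = edge_point (f \<lfloor>r\<rfloor>) (f (\<lfloor>r\<rfloor> + 1)) (y - z)" if "z \<le> y" "y \<le> m" for y
        using curve_edge[of "y - z" f "\<lfloor>r\<rfloor>"] that by (simp add: z_def m_def)
      have "dist (curve f r) (curve f x) \<le> \<bar>(r - z) - (x - z)\<bar>"
        using pt[of r] pt[of x] dist_edge_le[OF arcs, of "r - z" "x - z" "\<lfloor>r\<rfloor>"] z that
        by (simp add: m_def)
      then show ?thesis using that by simp
    qed
    show ?case
    proof (cases "s \<le> m")
      case True
      then show ?thesis using edge Suc.prems by simp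
    next
      case False
      have "\<lfloor>m\<rfloor> = \<lfloor>r\<rfloor> + 1" by (simp add: m_def z_def)
      then have "dist (curve f m) (curve f s) \<le> s - m"
        using Suc.prems False by (intro Suc.IH) (auto simp: m_def z_def)
      moreover have "dist (curve f r) (curve f m) \<le> m - r"
        using z by (intro edge) auto
      ultimately show ?thesis
        using dist_triangle[OF curve_in_points curve_in_points curve_in_points, of f f f r s m] arcs
        by simp
    qed
  qed
  from this[of r s "nat \<lceil>s - of_int \<lfloor>r\<rfloor>\<rceil>"] \<open>r \<le> s\<close> show ?thesis by linarith
qed

text \<open>One of the two arcs between two points of a closed curve has at most half of its length;
  the arc through the origin is obtained by shifting one parameter by a period.\<close>

lemma closed_curve_dist:
  assumes arcs: "\<And>i. (f i, f (i + 1)) \<in> parcs G" and per: "\<And>i. f (i + L) = f i"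
    and "0 \<le> r" "r \<le> of_int L" "0 \<le> s" "s \<le> of_int L"
  shows "dist (curve f r) (curve f s) \<le> of_int L / 2"
proof -
  have "dist (curve f r) (curve f s) \<le> of_int L / 2"
    if "0 \<le> r" "r \<le> s" "s \<le> of_int L" for r s
  proof (cases "s - r \<le> of_int L / 2")
    case True
    then show ?thesis using curve_lipschitz[of f r s, OF arcs] that by simp
  next
    case False
    have "dist (curve f s) (curve f (r + of_int L)) \<le> r + of_int L - s"
      using curve_lipschitz[of f s "r + of_int L", OF arcs] that by simp
    then show ?thesis using False curve_periodic[of f L r, OF per] dist_sym by simp
  qed
  from this[of r s] this[of s r] assms(3-6) dist_sym[of "curve f r" "curve f s"]
  show ?thesis by linarith
qed

end

text \<open>The periodic extension to the integers; it removes the index 0 as an exception and lets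
  a cycle be traversed in both directions from any vertex.\<close>

definition cyc :: "(nat \<Rightarrow> 'a) \<Rightarrow> nat \<Rightarrow> int \<Rightarrow> 'a" where
  "cyc c k i = c (nat (i mod int k))"

lemma cyc_periodic: "cyc c k (i + int k) = cyc c k i"
  by (simp add: cyc_def)

lemma cyc_of_nat: "i < k \<Longrightarrow> cyc c k (int i) = c i"
  by (simp add: cyc_def flip: zmod_int)

lemma cyc_arc:
  assumes "0 < k" "\<And>i. i < k \<Longrightarrow> (c i, c (Suc i mod k)) \<in> parcs G"
  shows "(cyc c k i, cyc c k (i + 1)) \<in> parcs G"
proof -
  define j where "j = nat (i mod int k)"
  have "0 \<le> i mod int k" "i mod int k < int k" using assms(1) by auto
  then have j: "j < k" "int j = i mod int k" by (auto simp: j_def)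
  have "(i + 1) mod int k = (int j + 1) mod int k" by (simp only: j(2) mod_add_left_eq)
  also have "\<dots> = int (Suc j mod k)" by (simp add: zmod_int add.commute)
  finally have "nat ((i + 1) mod int k) = Suc j mod k" by simp
  then show ?thesis using assms(2)[OF j(1)] by (simp add: cyc_def j_def)
qed

lemma cyc_inj:
  assumes "inj_on c {..<k}" "cyc c k i = cyc c k j" "\<bar>i - j\<bar> < int k"
  shows "i = j"
proof -
  have k: "0 < k" using assms(3) by linarith
  then have bd: "0 \<le> x mod int k" "x mod int k < int k" for x by auto
  then have "nat (x mod int k) < k" for x using bd[of x] by linarith
  then have "nat (i mod int k) = nat (j mod int k)"
    using inj_onD[OF assms(1) assms(2)[unfolded cyc_def]] by simp
  then have "i mod int k = j mod int k" using bd[of i] bd[of j] by linarith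
  then have "int k dvd i - j" by (simp add: mod_eq_dvd_iff)
  then show ?thesis using assms(3) dvd_imp_le_int[of "i - j" "int k"] by fastforce
qed

context conn_graph
begin

text \<open>A walk shorter than both arcs, combined with the shorter of the arcs, would yield a
  cycle of length below the girth.\<close>

lemma shortest_cycle_walk:
  assumes "girth G = enat g" "is_cycle G c g" "0 \<le> d" "d \<le> int g"
    and walk: "(cyc c g i, cyc c g (i + d)) \<in> parcs G ^^ m"
  shows "min d (int g - d) \<le> int m"
proof (rule ccontr)
  assume "\<not> ?thesis"
  then have m: "int m < d" "int m < int g - d" by auto
  have c: "3 \<le> g" "inj_on c {..<g}" "\<And>i. (cyc c g i, cyc c g (i + 1)) \<in> parcs G"
    using assms(2) cyc_arc[of g c G] by (auto simp: is_cycle_def)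
  from shortest_walk_path[OF walk] obtain P l where P: "l \<le> m" "P 0 = cyc c g i"
    "P l = cyc c g (i + d)" "inj_on P {..l}" "\<And>i. i < l \<Longrightarrow> (P i, P (Suc i)) \<in> parcs G"
    by metis
  have "\<exists>c' k. is_cycle G c' k \<and> k < g"
  proof (cases "d \<le> int g - d")
    case True
    let ?Q = "\<lambda>x. cyc c g (i + int x)"
    have "\<exists>c' k. is_cycle G c' k \<and> k \<le> l + nat d"
    proof (rule two_paths_cycle[OF P(4,5)])
      show "inj_on ?Q {..nat d}"
        using True m by (auto intro!: inj_onI dest!: cyc_inj[OF c(2)])
      show "(?Q x, ?Q (Suc x)) \<in> parcs G" for x
        using c(3)[of "i + int x"] by (simp add: algebra_simps)
    qed (use P m assms in auto)
    then obtain c' k where "is_cycle G c' k" "k \<le> l + nat d" by blast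
    moreover have "l + nat d < g" using True m P(1) by linarith
    ultimately show ?thesis by force
  next
    case False
    let ?Q = "\<lambda>x. cyc c g (i - int x)"
    have "\<exists>c' k. is_cycle G c' k \<and> k \<le> l + nat (int g - d)"
    proof (rule two_paths_cycle[OF P(4,5)])
      show "inj_on ?Q {..nat (int g - d)}"
        using False m by (auto intro!: inj_onI dest!: cyc_inj[OF c(2)])
      show "(?Q x, ?Q (Suc x)) \<in> parcs G" for x
        using arcs_sym[OF c(3)[of "i - int (Suc x)"]] by (simp add: algebra_simps)
      show "P l = ?Q (nat (int g - d))"
        using P(3) assms(4) cyc_periodic[of c g "i + d - int g"] by (simp add: algebra_simps)
    qed (use P m assms in auto)
    then obtain c' k where "is_cycle G c' k" "k \<le> l + nat (int g - d)" by blast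
    moreover have "l + nat (int g - d) < g" using False m P(1) by linarith
    ultimately show ?thesis by force
  qed
  then show False using girth_eqD(2)[OF assms(1)] by fastforce
qed

end

context conn_graph
begin

section \<open>Geodesics\<close>

text \<open>The bound makes the set under the supremum in \<open>hyperbolicity\<close> bounded and
  the set under the infimum in \<open>triangle_delta\<close> nonempty.\<close>

lemma dist_bounded:
  obtains B where "0 \<le> B" "\<And>p q. p \<in> points G \<Longrightarrow> q \<in> points G \<Longrightarrow> dist p q \<le> B"
proof -
  let ?D = "(\<lambda>(u, v). dist (vertex_point u) (vertex_point v)) ` (pverts G \<times> pverts G)"
  have fin: "finite ?D" using finite_verts by simp
  have near: "\<exists>u\<in>pverts G. dist p (vertex_point u) \<le> 1" if "p \<in> points G" for p
    using that
  proof (cases rule: points_cases)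
    case (vertex u)
    then show ?thesis using dist_self[OF that] by (intro bexI[of _ u]) auto
  next
    case (edge u v t)
    then have "dist p (vertex_point u) \<le> \<bar>t - 0\<bar>" using dist_edge_le[of u v t 0] by simp
    then show ?thesis using edge arcs_verts[of u v] by (intro bexI[of _ u]) auto
  qed
  have le: "dist p q \<le> Max ?D + 2" if pq: "p \<in> points G" "q \<in> points G" for p q
  proof -
    obtain u v where uv: "u \<in> pverts G" "dist p (vertex_point u) \<le> 1"
      "v \<in> pverts G" "dist q (vertex_point v) \<le> 1"
      using near pq by meson
    have "dist (vertex_point u) (vertex_point v) \<le> Max ?D" using uv by (intro Max_ge[OF fin]) auto
    then show ?thesis
      using dist_triangle[of p "vertex_point u" q] dist_triangle[of "vertex_point u" "vertex_point v" q]
        dist_sym[of q "vertex_point v"] uv pq vertex_in_points by simp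
  qed
  obtain u where "u \<in> pverts G" using verts_nonempty by blast
  then have "0 \<le> Max ?D + 2"
    using le[of "vertex_point u" "vertex_point u"] dist_self vertex_in_points by force
  then show thesis using le that by blast
qed

definition geodesic_path :: "(real \<Rightarrow> 'a point) \<Rightarrow> real \<Rightarrow> bool" where
  "geodesic_path \<gamma> l \<longleftrightarrow> 0 \<le> l \<and> \<gamma> \<in> {0..l} \<rightarrow> points G \<and>
    (\<forall>s\<in>{0..l}. \<forall>t\<in>{0..l}. dist (\<gamma> s) (\<gamma> t) = \<bar>s - t\<bar>)"

lemma is_geodesic_iff:
  assumes "x \<in> points G" "y \<in> points G"
  shows "is_geodesic G x y S \<longleftrightarrow>
    (\<exists>\<gamma> l. geodesic_path \<gamma> l \<and> \<gamma> 0 = x \<and> \<gamma> l = y \<and> S = \<gamma> ` {0..l})"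
proof
  assume "is_geodesic G x y S"
  then show "\<exists>\<gamma> l. geodesic_path \<gamma> l \<and> \<gamma> 0 = x \<and> \<gamma> l = y \<and> S = \<gamma> ` {0..l}"
    unfolding is_geodesic_def geodesic_path_def using dist_nonneg[OF assms] by blast
next
  assume "\<exists>\<gamma> l. geodesic_path \<gamma> l \<and> \<gamma> 0 = x \<and> \<gamma> l = y \<and> S = \<gamma> ` {0..l}"
  then obtain \<gamma> l where \<gamma>: "geodesic_path \<gamma> l" "\<gamma> 0 = x" "\<gamma> l = y" "S = \<gamma> ` {0..l}" by blast
  have l: "0 \<le> l" using \<gamma>(1) by (simp add: geodesic_path_def)
  have "\<forall>s\<in>{0..l}. \<forall>t\<in>{0..l}. dist (\<gamma> s) (\<gamma> t) = \<bar>s - t\<bar>"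
    using \<gamma>(1) by (simp add: geodesic_path_def)
  from bspec[OF bspec[OF this, of 0], of l] l have "dist x y = l"
    unfolding \<gamma>(2)[symmetric] \<gamma>(3)[symmetric] by simp
  then show "is_geodesic G x y S"
    using \<gamma> unfolding is_geodesic_def geodesic_path_def by (intro exI[of _ \<gamma>]) auto
qed

lemma geodesic_path_subset: "geodesic_path \<gamma> l \<Longrightarrow> \<gamma> ` {0..l} \<subseteq> points G"
  by (auto simp: geodesic_path_def)

lemma geodesic_subset:
  assumes "x \<in> points G" "y \<in> points G" "is_geodesic G x y S"
  shows "S \<subseteq> points G" "x \<in> S" "y \<in> S"
proof -
  obtain \<gamma> l where \<gamma>: "geodesic_path \<gamma> l" "\<gamma> 0 = x" "\<gamma> l = y" "S = \<gamma> ` {0..l}"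
    using assms(3) unfolding is_geodesic_iff[OF assms(1,2)] by blast
  have "0 \<in> {0..l}" "l \<in> {0..l}" using \<gamma>(1) by (auto simp: geodesic_path_def)
  then show "S \<subseteq> points G" "x \<in> S" "y \<in> S"
    using \<gamma> geodesic_path_subset[OF \<gamma>(1)] by auto
qed

lemma geodesic_singleton:
  assumes "x \<in> points G"
  shows "is_geodesic G x x {x}"
  unfolding is_geodesic_iff[OF assms assms]
  using assms dist_self[OF assms]
  by (intro exI[of _ "\<lambda>_. x"] exI[of _ 0]) (auto simp: geodesic_path_def)

lemma triangle_delta_le:
  assumes "0 \<le> D" "S \<subseteq> neighbourhood G D (T \<union> U)" "T \<subseteq> neighbourhood G D (U \<union> S)"
    "U \<subseteq> neighbourhood G D (S \<union> T)"
  shows "triangle_delta G S T U \<le> D"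
  unfolding triangle_delta_def by (rule cInf_lower) (use assms in \<open>auto intro!: bdd_belowI[of _ 0]\<close>)

lemma hyperbolicity_greatest:
  assumes xyz: "x \<in> points G" "y \<in> points G" "z \<in> points G"
    and sides: "is_geodesic G x y S" "is_geodesic G y z T" "is_geodesic G z x U"
    and p: "p \<in> S" "\<And>q. q \<in> T \<union> U \<Longrightarrow> h \<le> dist p q"
  shows "h \<le> hyperbolicity G"
proof -
  obtain B where B: "0 \<le> B" "\<And>p q. p \<in> points G \<Longrightarrow> q \<in> points G \<Longrightarrow> dist p q \<le> B"
    using dist_bounded by blast
  have nb: "V \<subseteq> neighbourhood G B W" if "V \<subseteq> points G" "w \<in> W" "w \<in> points G" for V W w
    using that B(2) unfolding neighbourhood_def by blast
  have delta: "triangle_delta G S T U \<le> B \<and> B \<in> {\<delta>. 0 \<le> \<delta> \<and> S \<subseteq> neighbourhood G \<delta> (T \<union> U) \<and>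
      T \<subseteq> neighbourhood G \<delta> (U \<union> S) \<and> U \<subseteq> neighbourhood G \<delta> (S \<union> T)}"
    if "x \<in> points G" "y \<in> points G" "z \<in> points G"
      "is_geodesic G x y S" "is_geodesic G y z T" "is_geodesic G z x U" for x y z S T U
  proof -
    note S = geodesic_subset[OF that(1,2,4)] and T = geodesic_subset[OF that(2,3,5)]
      and U = geodesic_subset[OF that(3,1,6)]
    have "S \<subseteq> neighbourhood G B (T \<union> U)" by (rule nb[of _ z]) (use S T U that in auto)
    moreover have "T \<subseteq> neighbourhood G B (U \<union> S)" by (rule nb[of _ x]) (use S T U that in auto)
    moreover have "U \<subseteq> neighbourhood G B (S \<union> T)" by (rule nb[of _ y]) (use S T U that in auto)
    ultimately show ?thesis using B(1) triangle_delta_le[of B S T U] by auto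
  qed
  let ?T = "{triangle_delta G S T U | x y z S T U.
     x \<in> points G \<and> y \<in> points G \<and> z \<in> points G \<and>
     is_geodesic G x y S \<and> is_geodesic G y z T \<and> is_geodesic G z x U}"
  have "h \<le> triangle_delta G S T U"
    unfolding triangle_delta_def
  proof (rule cInf_greatest)
    show "{\<delta>. 0 \<le> \<delta> \<and> S \<subseteq> neighbourhood G \<delta> (T \<union> U) \<and> T \<subseteq> neighbourhood G \<delta> (U \<union> S) \<and>
        U \<subseteq> neighbourhood G \<delta> (S \<union> T)} \<noteq> {}"
      using delta[OF xyz sides] by blast
    fix \<delta> assume "\<delta> \<in> {\<delta>. 0 \<le> \<delta> \<and> S \<subseteq> neighbourhood G \<delta> (T \<union> U) \<and>
        T \<subseteq> neighbourhood G \<delta> (U \<union> S) \<and> U \<subseteq> neighbourhood G \<delta> (S \<union> T)}"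
    then have "p \<in> neighbourhood G \<delta> (T \<union> U)" using p(1) by blast
    then obtain q where "q \<in> T \<union> U" "dist p q \<le> \<delta>" unfolding neighbourhood_def by blast
    then show "h \<le> \<delta>" using p(2)[of q] by linarith
  qed
  also have "\<dots> \<le> hyperbolicity G"
    unfolding hyperbolicity_def
  proof (rule cSup_upper)
    show "triangle_delta G S T U \<in> ?T" using xyz sides by blast
    show "bdd_above ?T" using delta by (intro bdd_aboveI[of _ B]) blast
  qed
  finally show ?thesis .
qed

section \<open>Shortest cycles are isometric\<close>

context
  fixes c :: "nat \<Rightarrow> 'a" and g :: nat and f :: "int \<Rightarrow> 'a"
  assumes girth: "girth G = enat g" and cycle: "is_cycle G c g" and g5: "5 \<le> g"
  defines "f \<equiv> cyc c g"
begin

lemma shortest_cycle_arc: "(f i, f (i + 1)) \<in> parcs G"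
  unfolding f_def using cycle by (intro cyc_arc) (auto simp: is_cycle_def)

lemma shortest_cycle_vert: "f i \<in> pverts G"
  using arcs_verts[OF shortest_cycle_arc] by blast

lemma shortest_cycle_periodic: "f (i + int g) = f i"
  by (simp add: f_def cyc_periodic)

lemma shortest_cycle_dist_vertices:
  assumes "0 \<le> d" "d \<le> int g"
  shows "of_int (min d (int g - d)) \<le> dist (vertex_point (f i)) (vertex_point (f (i + d)))"
proof -
  have "real (nat (min d (int g - d))) \<le> dist (vertex_point (f i)) (vertex_point (f (i + d)))"
  proof (rule walk_bounds_dist[OF shortest_cycle_vert shortest_cycle_vert])
    fix m assume "(f i, f (i + d)) \<in> parcs G ^^ m"
    then show "nat (min d (int g - d)) \<le> m"
      using shortest_cycle_walk[OF girth cycle assms] unfolding f_def by fastforce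
  qed
  then show ?thesis using assms by simp
qed

text \<open>A path from a point of an edge to a vertex passes one of the two ends of the edge, so
  the bound between vertices carries over.\<close>

lemma shortest_cycle_dist_vertex:
  assumes "0 \<le> u" "u \<le> real g"
  shows "min u (real g - u) \<le> dist (vertex_point (f i)) (curve f (of_int i + u))"
proof (cases "u = real g")
  case True
  have "0 \<le> dist (vertex_point (f i)) (curve f (of_int i + u))"
    by (intro dist_nonneg vertex_in_points shortest_cycle_vert curve_in_points shortest_cycle_arc)
  then show ?thesis using True by simp
next
  case False
  define m where "m = \<lfloor>u\<rfloor>"
  define s where "s = u - of_int m"
  have s: "0 \<le> s" "s < 1" "u = of_int m + s" unfolding s_def m_def by linarith+
  have m: "0 \<le> m" "m + 1 \<le> int g" using assms False unfolding m_def by linarith+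
  have "curve f (of_int (i + m) + s) = edge_point (f (i + m)) (f (i + m + 1)) s"
    using s by (intro curve_edge) auto
  then have pt: "curve f (of_int i + u) = edge_point (f (i + m)) (f (i + m + 1)) s"
    using s(3) by (simp add: add.assoc)
  have "min u (real g - u) \<le> dist (edge_point (f (i + m)) (f (i + m + 1)) s) (vertex_point (f i))"
  proof (rule dist_vertex_exit[OF shortest_cycle_arc _ _ shortest_cycle_vert])
    have "of_int (min m (int g - m)) \<le> dist (vertex_point (f (i + m))) (vertex_point (f i))"
      using shortest_cycle_dist_vertices[of m i] m dist_sym by simp
    then show "min u (real g - u) \<le> s + dist (vertex_point (f (i + m))) (vertex_point (f i))"
      using s m unfolding min_def by (auto split: if_splits)
    have "of_int (min (m + 1) (int g - (m + 1))) \<le>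
        dist (vertex_point (f (i + m + 1))) (vertex_point (f i))"
      using shortest_cycle_dist_vertices[of "m + 1" i] m dist_sym by (simp add: add.assoc)
    then show "min u (real g - u) \<le> 1 - s + dist (vertex_point (f (i + m + 1))) (vertex_point (f i))"
      using s m unfolding min_def by (auto split: if_splits)
  qed (use s in auto)
  then show ?thesis using pt dist_sym by simp
qed

text \<open>The ends of the edge that carries \<open>curve f v\<close> are at least g/2 - t and g/2
  - (1 - t) away from the antipode, and reaching them costs t and 1 - t.\<close>

lemma shortest_cycle_antipodal: "real g / 2 \<le> dist (curve f v) (curve f (v + real g / 2))"
proof -
  define i where "i = \<lfloor>v\<rfloor>"
  define t where "t = v - of_int i"
  have t: "0 \<le> t" "t < 1" "v = of_int i + t" unfolding t_def i_def by linarith+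
  let ?q = "curve f (v + real g / 2)"
  have q: "?q \<in> points G" by (intro curve_in_points shortest_cycle_arc)
  have a: "real g / 2 - t \<le> dist (vertex_point (f i)) ?q"
    using shortest_cycle_dist_vertex[of "t + real g / 2" i] t g5
    by (cases "t = 0") (auto simp: add.assoc min_def)
  have b: "real g / 2 - (1 - t) \<le> dist (vertex_point (f (i + 1))) ?q"
    using shortest_cycle_dist_vertex[of "t + real g / 2 - 1" "i + 1"] t g5
    by (simp add: algebra_simps min_def)
  have "real g / 2 \<le> dist (edge_point (f i) (f (i + 1)) t) ?q"
  proof (rule dist_exit[OF shortest_cycle_arc _ _ q])
    fix s :: real assume s: "s \<in> {0..1}" "?q = edge_point (f i) (f (i + 1)) s"
    have "dist (vertex_point (f i)) ?q \<le> s"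
      using dist_edge_le[OF shortest_cycle_arc[of i], of 0 s] s by simp
    moreover have "dist (vertex_point (f (i + 1))) ?q \<le> 1 - s"
      using dist_edge_le[OF shortest_cycle_arc[of i], of 1 s] s by simp
    \<comment> \<open>The antipode cannot lie on the same edge: \<open>a\<close> and
      \<open>b\<close> would add up to g - 1 \<le> 1.\<close>
    ultimately show "real g / 2 \<le> \<bar>t - s\<bar>" using a b g5 by linarith
  qed (use a b t in auto)
  moreover have "curve f v = edge_point (f i) (f (i + 1)) t"
    unfolding t(3) using t by (intro curve_edge) auto
  ultimately show ?thesis by simp
qed

text \<open>The three pieces have lengths at most s, t - s and g/2 - t, while the ends are at least
  g/2 apart; so all these bounds are attained.\<close>

lemma shortest_cycle_half_geodesic:
  "is_geodesic G (curve f v) (curve f (v + real g / 2)) ((\<lambda>s. curve f (v + s)) ` {0..real g / 2})"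
proof -
  have pts: "curve f r \<in> points G" for r by (intro curve_in_points shortest_cycle_arc)
  have dist: "dist (curve f (v + s)) (curve f (v + t)) = t - s"
    if st: "0 \<le> s" "s \<le> t" "t \<le> real g / 2" for s t
  proof -
    note lip = curve_lipschitz[of f, OF shortest_cycle_arc]
    have "dist (curve f v) (curve f (v + s)) \<le> s" using lip[of v "v + s"] st by simp
    moreover have "dist (curve f (v + s)) (curve f (v + t)) \<le> t - s"
      using lip[of "v + s" "v + t"] st by simp
    moreover have "dist (curve f (v + t)) (curve f (v + real g / 2)) \<le> real g / 2 - t"
      using lip[of "v + t" "v + real g / 2"] st by simp
    ultimately show ?thesis
      using dist_triangle[OF pts pts pts, of v "v + s" "v + real g / 2"] shortest_cycle_antipodal[of v]
        dist_triangle[OF pts pts pts, of "v + s" "v + t" "v + real g / 2"]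
        dist_triangle[OF pts pts pts, of v "v + real g / 2" "v + s"]
        dist_triangle[OF pts pts pts, of "v + s" "v + real g / 2" "v + t"] by linarith
  qed
  have "geodesic_path (\<lambda>s. curve f (v + s)) (real g / 2)"
    unfolding geodesic_path_def
  proof (intro conjI ballI)
    fix s t assume "s \<in> {0..real g / 2}" "t \<in> {0..real g / 2}"
    then show "dist (curve f (v + s)) (curve f (v + t)) = \<bar>s - t\<bar>"
      using dist[of s t] dist[of t s] dist_sym[of "curve f (v + s)" "curve f (v + t)"]
      by (cases "s \<le> t") auto
  qed (use pts in auto)
  then show ?thesis unfolding is_geodesic_iff[OF pts pts]
    by (intro exI[of _ "\<lambda>s. curve f (v + s)"] exI[of _ "real g / 2"]) simp
qed

text \<open>The bigon is a triangle with a trivial third side. Its ends are placed at -g/4 and g/4,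
  so that the midpoint of one side is the vertex \<open>f 0\<close> and
  \<open>shortest_cycle_dist_vertex\<close> applies to it.\<close>

lemma hyperbolicity_ge: "real g / 4 \<le> hyperbolicity G"
proof -
  let ?h = "real g / 4"
  have pts: "curve f r \<in> points G" for r by (intro curve_in_points shortest_cycle_arc)
  have per: "curve f (?h + real g / 2) = curve f (- ?h)"
    using curve_periodic[of f "int g" "- ?h"] shortest_cycle_periodic by simp
  show ?thesis
  proof (rule hyperbolicity_greatest[OF pts pts pts])
    show "is_geodesic G (curve f (- ?h)) (curve f ?h)
        ((\<lambda>s. curve f (- ?h + s)) ` {0..real g / 2})"
      using shortest_cycle_half_geodesic[of "- ?h"] by simp
    show "is_geodesic G (curve f ?h) (curve f (- ?h)) ((\<lambda>s. curve f (?h + s)) ` {0..real g / 2})"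
      using shortest_cycle_half_geodesic[of ?h] per by simp
    show "is_geodesic G (curve f (- ?h)) (curve f (- ?h)) {curve f (- ?h)}"
      by (rule geodesic_singleton[OF pts])
    show "curve f 0 \<in> (\<lambda>s. curve f (- ?h + s)) ` {0..real g / 2}"
      by (rule image_eqI[of _ _ ?h]) auto
    have far: "?h \<le> dist (curve f 0) (curve f (?h + s))" if "0 \<le> s" "s \<le> real g / 2" for s
      using shortest_cycle_dist_vertex[of "?h + s" 0] that curve_of_int[of f 0] by simp
    fix q assume "q \<in> (\<lambda>s. curve f (?h + s)) ` {0..real g / 2} \<union> {curve f (- ?h)}"
    then show "?h \<le> dist (curve f 0) q"
      using far per[symmetric] far[of "real g / 2"] by auto
  qed
qed

end

section \<open>Gates\<close>

text \<open>The intermediate value property stands in for connectedness of \<open>S\<close>.\<close>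

definition links :: "'a point set \<Rightarrow> 'a point \<Rightarrow> 'a point \<Rightarrow> bool" where
  "links S x y \<longleftrightarrow> (\<forall>f. lipschitz1 f \<longrightarrow> lin_ext f x \<le> 0 \<longrightarrow> 0 \<le> lin_ext f y \<longrightarrow>
    (\<exists>w\<in>S. lin_ext f w = 0))"

lemma linksD:
  "links S x y \<Longrightarrow> lipschitz1 f \<Longrightarrow> lin_ext f x \<le> 0 \<Longrightarrow> 0 \<le> lin_ext f y \<Longrightarrow> \<exists>w\<in>S. lin_ext f w = 0"
  by (simp add: links_def)

lemma lin_ext_uminus: "lin_ext (\<lambda>w. - f w) p = - lin_ext f p"
  by (simp add: lin_ext_def sum_negf)

lemma lipschitz1_uminus: "lipschitz1 f \<Longrightarrow> lipschitz1 (\<lambda>w. - f w)"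
  by (fastforce simp: lipschitz1_def)

lemma links_sym:
  assumes "links S x y"
  shows "links S y x"
  unfolding links_def
proof (intro allI impI)
  fix f assume "lipschitz1 f" "lin_ext f y \<le> 0" "0 \<le> lin_ext f x"
  with linksD[OF assms lipschitz1_uminus] show "\<exists>w\<in>S. lin_ext f w = 0"
    by (simp add: lin_ext_uminus)
qed

lemma links_trans:
  assumes "links S x y" "links T y z"
  shows "links (S \<union> T) x z"
  unfolding links_def
proof (intro allI impI)
  fix f assume f: "lipschitz1 f" "lin_ext f x \<le> 0" "0 \<le> lin_ext f z"
  show "\<exists>w\<in>S \<union> T. lin_ext f w = 0"
    using linksD[OF assms(1) f(1,2)] linksD[OF assms(2) f(1) _ f(3)]
    by (cases "0 \<le> lin_ext f y") auto
qed

text \<open>Stated for both signs, since a geodesic may cross a gate in either direction.\<close>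

lemma geodesic_path_zero:
  assumes \<gamma>: "geodesic_path \<gamma> l" and f: "lipschitz1 f"
    and ab: "0 \<le> a" "a \<le> b" "b \<le> l"
    and sign: "lin_ext f (\<gamma> a) \<le> 0 \<and> 0 \<le> lin_ext f (\<gamma> b) \<or>
      0 \<le> lin_ext f (\<gamma> a) \<and> lin_ext f (\<gamma> b) \<le> 0"
  shows "\<exists>c\<in>{a..b}. lin_ext f (\<gamma> c) = 0"
proof -
  let ?F = "\<lambda>s. lin_ext f (\<gamma> s)"
  have "\<bar>?F t - ?F s\<bar> \<le> \<bar>s - t\<bar>" if "s \<in> {0..l}" "t \<in> {0..l}" for s t
    using lin_ext_lipschitz[OF f, of "\<gamma> s" "\<gamma> t"] \<gamma> that by (auto simp: geodesic_path_def Pi_iff)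
  then have lip: "\<bar>?F t - ?F s\<bar> \<le> \<bar>t - s\<bar>" if "s \<in> {a..b}" "t \<in> {a..b}" for s t
    using that ab by (simp add: abs_minus_commute)
  have "continuous_on {a..b} ?F"
    unfolding continuous_on_def
  proof (intro ballI tendstoI)
    fix s \<epsilon> :: real assume s: "s \<in> {a..b}" and "0 < \<epsilon>"
    then show "\<forall>\<^sub>F t in at s within {a..b}. Real_Vector_Spaces.dist (?F t) (?F s) < \<epsilon>"
      unfolding eventually_at dist_real_def
      using lip[OF s] by (intro exI[of _ \<epsilon>]) (auto intro: order_le_less_trans[OF lip[OF s]])
  qed
  then show ?thesis
    using IVT'[of ?F a 0 b] IVT2'[of ?F b 0 a] sign ab(2) by force
qed

lemma geodesic_links:
  assumes "x \<in> points G" "y \<in> points G" "is_geodesic G x y S"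
  shows "links S x y"
  unfolding links_def
proof (intro allI impI)
  fix f assume f: "lipschitz1 f" "lin_ext f x \<le> 0" "0 \<le> lin_ext f y"
  obtain \<gamma> l where \<gamma>: "geodesic_path \<gamma> l" "\<gamma> 0 = x" "\<gamma> l = y" "S = \<gamma> ` {0..l}"
    using assms(3) unfolding is_geodesic_iff[OF assms(1,2)] by blast
  then have "0 \<le> l" by (simp add: geodesic_path_def)
  from geodesic_path_zero[OF \<gamma>(1) f(1) _ this] \<gamma> f show "\<exists>w\<in>S. lin_ext f w = 0" by auto
qed

text \<open>Of the other two sides of a triangle only this is kept: their union contains the ends of
  the third side and links them. The bound is applied to each side in turn.\<close>

lemma hyperbolicity_le:
  assumes "0 \<le> D"
    and near: "\<And>\<gamma> l \<sigma> s. geodesic_path \<gamma> l \<Longrightarrow> \<sigma> \<subseteq> points G \<Longrightarrow> \<gamma> 0 \<in> \<sigma> \<Longrightarrow> \<gamma> l \<in> \<sigma> \<Longrightarrow>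
      links \<sigma> (\<gamma> 0) (\<gamma> l) \<Longrightarrow> s \<in> {0..l} \<Longrightarrow> \<exists>w\<in>\<sigma>. dist (\<gamma> s) w \<le> D"
  shows "hyperbolicity G \<le> D"
proof -
  have side: "S \<subseteq> neighbourhood G D (T \<union> U)"
    if pts: "x \<in> points G" "y \<in> points G" "z \<in> points G" and
      geo: "is_geodesic G x y S" "is_geodesic G y z T" "is_geodesic G z x U" for x y z S T U
  proof
    fix p assume p: "p \<in> S"
    obtain \<gamma> l where \<gamma>: "geodesic_path \<gamma> l" "\<gamma> 0 = x" "\<gamma> l = y" "S = \<gamma> ` {0..l}"
      using geo(1) unfolding is_geodesic_iff[OF pts(1,2)] by blast
    then obtain s where s: "s \<in> {0..l}" "p = \<gamma> s" using p by blast
    note sub = geodesic_subset[OF pts(1,2) geo(1)] geodesic_subset[OF pts(2,3) geo(2)]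
      geodesic_subset[OF pts(3,1) geo(3)]
    have "links (T \<union> U) x y"
      using links_trans[OF geodesic_links[OF pts(2,3) geo(2)] geodesic_links[OF pts(3,1) geo(3)]]
      by (rule links_sym)
    moreover have "T \<union> U \<subseteq> points G" "x \<in> T \<union> U" "y \<in> T \<union> U" using sub by blast+
    ultimately obtain w where "w \<in> T \<union> U" "dist (\<gamma> s) w \<le> D"
      using near[OF \<gamma>(1), of "T \<union> U" s] \<gamma>(2,3) s(1) by auto
    then show "p \<in> neighbourhood G D (T \<union> U)" using p s sub(1) by (auto simp: neighbourhood_def)
  qed
  obtain u where "u \<in> pverts G" using verts_nonempty by blast
  then have "vertex_point u \<in> points G" by (rule vertex_in_points)
  then have ne: "\<exists>x y z S T U. x \<in> points G \<and> y \<in> points G \<and> z \<in> points G \<and>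
     is_geodesic G x y S \<and> is_geodesic G y z T \<and> is_geodesic G z x U"
    using geodesic_singleton by blast
  show ?thesis
    unfolding hyperbolicity_def
  proof (rule cSup_least)
    fix t assume "t \<in> {triangle_delta G S T U | x y z S T U.
     x \<in> points G \<and> y \<in> points G \<and> z \<in> points G \<and>
     is_geodesic G x y S \<and> is_geodesic G y z T \<and> is_geodesic G z x U}"
    then obtain x y z S T U where t: "t = triangle_delta G S T U" "x \<in> points G" "y \<in> points G"
      "z \<in> points G" "is_geodesic G x y S" "is_geodesic G y z T" "is_geodesic G z x U" by blast
    show "t \<le> D" unfolding t(1)
      using side[OF t(2-7)] side[OF t(3,4,2,6,7,5)] side[OF t(4,2,3,7,5,6)]
      by (intro triangle_delta_le[OF assms(1)])
  qed (use ne in blast)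
qed

end

text \<open>
  The zero set of \<open>f i\<close>, extended linearly, is the \<open>i\<close>-th gate; \<open>e i\<close> bounds its diameter and \<open>\<Delta> i\<close>
  that of the cell between the gates \<open>i\<close> and \<open>i + 1\<close>.
\<close>

locale gated_graph = conn_graph G for G :: "'a pair_pre_digraph" +
  fixes f :: "nat \<Rightarrow> 'a \<Rightarrow> real" and N :: nat and e \<Delta> :: "nat \<Rightarrow> real" and D :: real
  assumes gate_lipschitz: "i \<le> N \<Longrightarrow> lipschitz1 (f i)"
    and gate_first: "p \<in> points G \<Longrightarrow> 0 \<le> lin_ext (f 0) p"
    and gate_last: "p \<in> points G \<Longrightarrow> lin_ext (f N) p < 0"
    and gate_nested: "i < N \<Longrightarrow> p \<in> points G \<Longrightarrow> 0 \<le> lin_ext (f (Suc i)) p \<Longrightarrow> 0 < lin_ext (f i) p"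
    and gate_diameter: "i \<le> N \<Longrightarrow> p \<in> points G \<Longrightarrow> q \<in> points G \<Longrightarrow>
      lin_ext (f i) p = 0 \<Longrightarrow> lin_ext (f i) q = 0 \<Longrightarrow> dist p q \<le> e i"
    and gate_convex: "i \<le> N \<Longrightarrow> p \<in> points G \<Longrightarrow> q \<in> points G \<Longrightarrow> r \<in> points G \<Longrightarrow>
      lin_ext (f i) p = 0 \<Longrightarrow> lin_ext (f i) r = 0 \<Longrightarrow> dist p q + dist q r = dist p r \<Longrightarrow>
      lin_ext (f i) q = 0"
    and cell_diameter: "i < N \<Longrightarrow> p \<in> points G \<Longrightarrow> q \<in> points G \<Longrightarrow>
      0 \<le> lin_ext (f i) p \<Longrightarrow> lin_ext (f (Suc i)) p \<le> 0 \<Longrightarrow>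
      0 \<le> lin_ext (f i) q \<Longrightarrow> lin_ext (f (Suc i)) q \<le> 0 \<Longrightarrow> dist p q \<le> \<Delta> i"
    and e_nonneg: "0 \<le> e i"
    and one_gate: "i < N \<Longrightarrow> \<Delta> i + e i \<le> 2 * D" "i < N \<Longrightarrow> \<Delta> i + e (Suc i) \<le> 2 * D"
    and two_gates: "i < N \<Longrightarrow> \<Delta> i + e i + e (Suc i) \<le> 2 * D \<or>
      (\<forall>p\<in>points G. 0 \<le> lin_ext (f i) p \<longrightarrow> lin_ext (f (Suc i)) p \<le> 0 \<longrightarrow>
        (\<forall>w\<in>points G. lin_ext (f i) w = 0 \<longrightarrow> dist p w \<le> D) \<or>
        (\<forall>w\<in>points G. lin_ext (f (Suc i)) w = 0 \<longrightarrow> dist p w \<le> D))"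
begin

abbreviation F where "F i \<equiv> lin_ext (f i)"

definition cell :: "nat \<Rightarrow> 'a point set" where
  "cell i = {p \<in> points G. 0 \<le> F i p \<and> F (Suc i) p \<le> 0}"

context
  fixes \<gamma> l \<sigma> s
  assumes \<gamma>: "geodesic_path \<gamma> l" and \<sigma>: "\<sigma> \<subseteq> points G" "\<gamma> 0 \<in> \<sigma>" "\<gamma> l \<in> \<sigma>"
    "links \<sigma> (\<gamma> 0) (\<gamma> l)" and s: "0 \<le> s" "s \<le> l"
begin

lemma path_point: "0 \<le> t \<Longrightarrow> t \<le> l \<Longrightarrow> \<gamma> t \<in> points G"
  using \<gamma> by (auto simp: geodesic_path_def)

lemma path_dist: "0 \<le> a \<Longrightarrow> a \<le> b \<Longrightarrow> b \<le> l \<Longrightarrow> dist (\<gamma> a) (\<gamma> b) = b - a"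
  using \<gamma> by (auto simp: geodesic_path_def)

text \<open>A geodesic that passes a gate and comes back would meet it before and after
  \<open>s\<close>; convexity of the gate then puts \<open>\<gamma> s\<close> on the gate
  itself.\<close>

lemma no_fold:
  assumes "i \<le> N" "F i (\<gamma> s) < 0 \<and> 0 < F i (\<gamma> 0) \<and> 0 < F i (\<gamma> l) \<or>
    0 < F i (\<gamma> s) \<and> F i (\<gamma> 0) < 0 \<and> F i (\<gamma> l) < 0"
  shows False
proof -
  have "\<exists>a\<in>{0..s}. F i (\<gamma> a) = 0"
    by (rule geodesic_path_zero[OF \<gamma> gate_lipschitz[OF assms(1)]]) (use assms(2) s in auto)
  moreover have "\<exists>b\<in>{s..l}. F i (\<gamma> b) = 0"
    by (rule geodesic_path_zero[OF \<gamma> gate_lipschitz[OF assms(1)]]) (use assms(2) s in auto)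
  ultimately obtain a b where ab: "0 \<le> a" "a \<le> s" "F i (\<gamma> a) = 0" "s \<le> b" "b \<le> l" "F i (\<gamma> b) = 0"
    by auto
  have "F i (\<gamma> s) = 0"
    by (rule gate_convex[OF assms(1) path_point[of a] path_point[of s] path_point[of b]])
      (use ab s path_dist in auto)
  then show False using assms(2) by linarith
qed

text \<open>The cell is chosen so that the two ends do not both lie beyond the same gate; hence an
  end beyond a gate forces \<open>\<sigma>\<close> to cross that gate.\<close>

lemma good_cell:
  obtains k where "k < N" "\<gamma> s \<in> cell k" "\<not> (F k (\<gamma> 0) < 0 \<and> F k (\<gamma> l) < 0)"
    "\<not> (0 < F (Suc k) (\<gamma> 0) \<and> 0 < F (Suc k) (\<gamma> l))"
proof -
  note pt = path_point[OF s]
  define k where "k = (GREATEST i. i \<le> N \<and> 0 \<le> F i (\<gamma> s))"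
  have k0: "0 \<le> N \<and> 0 \<le> F 0 (\<gamma> s)" using gate_first[OF pt] by simp
  have bnd: "\<And>i. i \<le> N \<and> 0 \<le> F i (\<gamma> s) \<Longrightarrow> i \<le> N" by simp
  have k: "k \<le> N \<and> 0 \<le> F k (\<gamma> s)"
    unfolding k_def by (rule GreatestI_nat[of "\<lambda>i. i \<le> N \<and> 0 \<le> F i (\<gamma> s)", OF k0 bnd])
  have kN: "k < N" using gate_last[OF pt] k by (cases "k = N") auto
  have "\<not> 0 \<le> F (Suc k) (\<gamma> s)"
  proof
    assume "0 \<le> F (Suc k) (\<gamma> s)"
    with kN have "Suc k \<le> N \<and> 0 \<le> F (Suc k) (\<gamma> s)" by simp
    from Greatest_le_nat[of "\<lambda>i. i \<le> N \<and> 0 \<le> F i (\<gamma> s)", OF this bnd] show False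
      by (simp add: k_def)
  qed
  then have k': "F (Suc k) (\<gamma> s) < 0" by simp
  have right: "\<not> (0 < F (Suc k) (\<gamma> 0) \<and> 0 < F (Suc k) (\<gamma> l))"
    using no_fold[of "Suc k"] k' kN by auto
  show thesis
  proof (cases "F k (\<gamma> 0) < 0 \<and> F k (\<gamma> l) < 0")
    case False
    then show ?thesis using that[of k] kN k k' right pt by (simp add: cell_def)
  next
    case True
    \<comment> \<open>Both ends can lie before gate \<open>k\<close> only if
      \<open>\<gamma> s\<close> is on this gate; it then belongs to the preceding cell as well,
      which has the required property.\<close>
    have Fk: "F k (\<gamma> s) = 0"
    proof (rule ccontr)
      assume "F k (\<gamma> s) \<noteq> 0"
      then have "0 < F k (\<gamma> s)" using k by simp
      then show False using no_fold[of k] k True by blast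
    qed
    have "k \<noteq> 0" using True gate_first[OF path_point[of 0]] s by (intro notI) simp
    then obtain j where j: "k = Suc j" by (cases k) auto
    have pos: "0 < F j (\<gamma> s)" using gate_nested[of j] kN j Fk pt by simp
    then have "\<not> (F j (\<gamma> 0) < 0 \<and> F j (\<gamma> l) < 0)" using no_fold[of j] kN j by auto
    then show ?thesis using that[of j] kN j pos Fk True pt by (auto simp: cell_def)
  qed
qed

text \<open>The price for passing from the geodesic to \<open>\<sigma>\<close> towards the end
  \<open>x\<close>: the diameter of the gate beyond which \<open>x\<close> lies, or nothing if
  \<open>x\<close>, which belongs to \<open>\<sigma>\<close>, is in the cell.\<close>

definition cost :: "nat \<Rightarrow> 'a point \<Rightarrow> real" where
  "cost k x = (if F k x < 0 then e k else if 0 < F (Suc k) x then e (Suc k) else 0)"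

text \<open>Here \<open>t\<close> is one end of the parameter interval, \<open>t'\<close> the other,
  and \<open>{a0..b0}\<close> is the piece between \<open>t\<close> and \<open>s\<close>, so one
  proof serves both ends. If \<open>\<gamma> t\<close> lies beyond a gate, this piece crosses the
  gate, and so does \<open>\<sigma>\<close>, because \<open>\<gamma> t'\<close> does not lie beyond
  it.\<close>

lemma guard:
  assumes k: "k < N" "\<gamma> s \<in> cell k"
    and t: "t = 0 \<and> t' = l \<and> a0 = 0 \<and> b0 = s \<or> t = l \<and> t' = 0 \<and> a0 = s \<and> b0 = l"
    and not_both: "\<not> (F k (\<gamma> 0) < 0 \<and> F k (\<gamma> l) < 0)"
      "\<not> (0 < F (Suc k) (\<gamma> 0) \<and> 0 < F (Suc k) (\<gamma> l))"
  shows "\<exists>a\<in>{a0..b0}. \<gamma> a \<in> cell k \<and> (\<exists>w\<in>\<sigma>. dist (\<gamma> a) w \<le> cost k (\<gamma> t))"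
proof -
  have range: "0 \<le> a0" "a0 \<le> b0" "b0 \<le> l" using t s by auto
  have lnk: "links \<sigma> (\<gamma> t) (\<gamma> t')" "links \<sigma> (\<gamma> t') (\<gamma> t)" using t \<sigma>(4) links_sym by auto
  have nb: "F k (\<gamma> t) < 0 \<Longrightarrow> 0 \<le> F k (\<gamma> t')" "0 < F (Suc k) (\<gamma> t) \<Longrightarrow> F (Suc k) (\<gamma> t') \<le> 0"
    using t not_both by auto
  have ps: "0 \<le> F k (\<gamma> s)" "F (Suc k) (\<gamma> s) \<le> 0" using k(2) by (auto simp: cell_def)
  consider (left) "F k (\<gamma> t) < 0" | (right) "\<not> F k (\<gamma> t) < 0" "0 < F (Suc k) (\<gamma> t)"
    | (inside) "\<not> F k (\<gamma> t) < 0" "\<not> 0 < F (Suc k) (\<gamma> t)" by blast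
  then show ?thesis
  proof cases
    case left
    have lip: "lipschitz1 (f k)" using k gate_lipschitz by simp
    obtain w where w: "w \<in> \<sigma>" "F k w = 0" using linksD[OF lnk(1) lip] left nb by auto
    have "\<exists>a\<in>{a0..b0}. F k (\<gamma> a) = 0"
      by (rule geodesic_path_zero[OF \<gamma> lip range]) (use t left ps in auto)
    then obtain a where a: "a \<in> {a0..b0}" "F k (\<gamma> a) = 0" by blast
    have pa: "\<gamma> a \<in> points G" using a range path_point by simp
    have "F (Suc k) (\<gamma> a) \<le> 0" using gate_nested[OF k(1) pa] a by (cases "0 \<le> F (Suc k) (\<gamma> a)") auto
    moreover have "dist (\<gamma> a) w \<le> e k" using gate_diameter[of k "\<gamma> a" w] a pa w \<sigma>(1) k by auto
    ultimately show ?thesis using a pa w left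
      by (intro bexI[of _ a] conjI bexI[of _ w]) (simp_all add: cell_def cost_def)
  next
    case right
    have lip: "lipschitz1 (f (Suc k))" using k gate_lipschitz by simp
    obtain w where w: "w \<in> \<sigma>" "F (Suc k) w = 0" using linksD[OF lnk(2) lip] right nb by auto
    have "\<exists>a\<in>{a0..b0}. F (Suc k) (\<gamma> a) = 0"
      by (rule geodesic_path_zero[OF \<gamma> lip range]) (use t right ps in auto)
    then obtain a where a: "a \<in> {a0..b0}" "F (Suc k) (\<gamma> a) = 0" by blast
    have pa: "\<gamma> a \<in> points G" using a range path_point by simp
    have "0 < F k (\<gamma> a)" using gate_nested[OF k(1) pa] a by simp
    moreover have "dist (\<gamma> a) w \<le> e (Suc k)"
      using gate_diameter[of "Suc k" "\<gamma> a" w] a pa w \<sigma>(1) k by auto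
    ultimately show ?thesis using a pa w right
      by (intro bexI[of _ a] conjI bexI[of _ w]) (simp_all add: cell_def cost_def)
  next
    case inside
    have "\<gamma> t \<in> points G" "\<gamma> t \<in> \<sigma>" using t s path_point \<sigma> by auto
    moreover have "t \<in> {a0..b0}" using t s by auto
    ultimately show ?thesis using inside dist_self
      by (intro bexI[of _ t] conjI bexI[of _ "\<gamma> t"]) (simp_all add: cell_def cost_def)
  qed
qed

text \<open>The points that \<open>guard\<close> finds on the two sides of \<open>s\<close> lie in
  one cell, so they are at most \<open>\<Delta> k\<close> apart. The two routes from
  \<open>\<gamma> s\<close> over them add up to at most \<open>\<Delta> k\<close> plus both costs,
  and the shorter one is at most half of that.\<close>

lemma gated_near: "\<exists>w\<in>\<sigma>. dist (\<gamma> s) w \<le> D"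
proof -
  note pt = path_point[OF s]
  obtain k where k: "k < N" "\<gamma> s \<in> cell k" "\<not> (F k (\<gamma> 0) < 0 \<and> F k (\<gamma> l) < 0)"
    "\<not> (0 < F (Suc k) (\<gamma> 0) \<and> 0 < F (Suc k) (\<gamma> l))"
    using good_cell .
  obtain a w where a: "0 \<le> a" "a \<le> s" "\<gamma> a \<in> cell k" "w \<in> \<sigma>" "dist (\<gamma> a) w \<le> cost k (\<gamma> 0)"
    using guard[OF k(1,2) _ k(3,4), of 0 l 0 s] by auto
  obtain b v where b: "s \<le> b" "b \<le> l" "\<gamma> b \<in> cell k" "v \<in> \<sigma>" "dist (\<gamma> b) v \<le> cost k (\<gamma> l)"
    using guard[OF k(1,2) _ k(3,4), of l 0 s l] by auto
  have "dist (\<gamma> a) (\<gamma> b) \<le> \<Delta> k"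
    using cell_diameter[OF k(1)] a(3) b(3) by (auto simp: cell_def)
  then have ab: "b - a \<le> \<Delta> k" using path_dist a b by simp
  have "dist (\<gamma> s) w \<le> (s - a) + cost k (\<gamma> 0)"
    using dist_triangle[OF pt path_point[of a], of w] a s path_dist[of a s] \<sigma>(1)
      dist_sym[of "\<gamma> s" "\<gamma> a"] by auto
  moreover have "dist (\<gamma> s) v \<le> (b - s) + cost k (\<gamma> l)"
    using dist_triangle[OF pt path_point[of b], of v] b s path_dist[of s b] \<sigma>(1) by auto
  ultimately have near: "dist (\<gamma> s) w \<le> (s - a) + cost k (\<gamma> 0)"
    "dist (\<gamma> s) v \<le> (b - s) + cost k (\<gamma> l)" by simp_all
  have half: ?thesis if "\<Delta> k + cost k (\<gamma> 0) + cost k (\<gamma> l) \<le> 2 * D"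
  proof -
    from near that ab have "dist (\<gamma> s) w \<le> D \<or> dist (\<gamma> s) v \<le> D" by linarith
    then show ?thesis using a(4) b(4) by blast
  qed
  have ends: "\<gamma> 0 \<in> points G" "\<gamma> l \<in> points G" using s path_point by auto
  show ?thesis
  proof (cases "\<Delta> k + e k + e (Suc k) \<le> 2 * D")
    case True
    have "cost k (\<gamma> 0) + cost k (\<gamma> l) \<le> e k + e (Suc k)"
      unfolding cost_def using k(3,4) e_nonneg[of k] e_nonneg[of "Suc k"] by auto
    then show ?thesis using half True by linarith
  next
    case False
    \<comment> \<open>Both gates have to be paid for only if the ends lie beyond different gates. By
      nesting, \<open>\<sigma>\<close> then crosses both of them, and \<open>two_gates\<close>
      supplies one whose points are all within \<open>D\<close>. Otherwise the total cost is at most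
      that of a single gate.\<close>
    show ?thesis
    proof (cases "F k (\<gamma> 0) < 0 \<and> 0 < F (Suc k) (\<gamma> l) \<or> F k (\<gamma> l) < 0 \<and> 0 < F (Suc k) (\<gamma> 0)")
      case True
      have lip: "lipschitz1 (f k)" "lipschitz1 (f (Suc k))" using k gate_lipschitz by auto
      have nest: "F (Suc k) p < 0" if "p \<in> points G" "F k p < 0" for p
        using gate_nested[OF k(1) that(1)] that(2) by (cases "0 \<le> F (Suc k) p") auto
      have nest': "0 < F k p" if "p \<in> points G" "0 < F (Suc k) p" for p
        using gate_nested[OF k(1) that(1)] that(2) by auto
      have "\<exists>w\<in>\<sigma>. F k w = 0"
        using True linksD[OF \<sigma>(4) lip(1)] linksD[OF links_sym[OF \<sigma>(4)] lip(1)] ends nest'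
        by (meson less_imp_le)
      moreover have "\<exists>w\<in>\<sigma>. F (Suc k) w = 0"
        using True linksD[OF \<sigma>(4) lip(2)] linksD[OF links_sym[OF \<sigma>(4)] lip(2)] ends nest
        by (meson less_imp_le)
      moreover have "(\<forall>w\<in>points G. F k w = 0 \<longrightarrow> dist (\<gamma> s) w \<le> D) \<or>
          (\<forall>w\<in>points G. F (Suc k) w = 0 \<longrightarrow> dist (\<gamma> s) w \<le> D)"
        using two_gates[OF k(1)] False k(2) by (auto simp: cell_def)
      ultimately show ?thesis using \<sigma>(1) by blast
    next
      case False
      then have "cost k (\<gamma> 0) + cost k (\<gamma> l) \<le> e k \<or> cost k (\<gamma> 0) + cost k (\<gamma> l) \<le> e (Suc k)"
        unfolding cost_def using k(3,4) e_nonneg[of k] e_nonneg[of "Suc k"] by auto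
      then show ?thesis using half one_gate[OF k(1)] by linarith
    qed
  qed
qed

end

lemma gated_hyperbolicity: "hyperbolicity G \<le> D"
proof (rule hyperbolicity_le)
  obtain u where "u \<in> pverts G" using verts_nonempty by blast
  then have u: "vertex_point u \<in> points G" by (rule vertex_in_points)
  have "geodesic_path (\<lambda>_. vertex_point u) 0" "links {vertex_point u} (vertex_point u) (vertex_point u)"
    using u dist_self[OF u] by (auto simp: geodesic_path_def links_def)
  from gated_near[OF this(1) _ _ _ this(2), of 0] show "0 \<le> D" using u dist_self[OF u] by simp
qed (use gated_near in auto)

end

section \<open>Supports of points, and functions with values -1, 0 and 1\<close>

context conn_graph
begin

text \<open>The support in barycentric coordinates: a single vertex, or the two ends of the edge
  that has the point in its interior.\<close>

definition ends :: "'a point \<Rightarrow> 'a set" where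
  "ends p = {w \<in> pverts G. p w \<noteq> 0}"

lemma ends_vertex: "u \<in> pverts G \<Longrightarrow> ends (vertex_point u) = {u}"
  by (auto simp: ends_def vertex_point_def)

lemma ends_edge: "(u, v) \<in> parcs G \<Longrightarrow> 0 < t \<Longrightarrow> t < 1 \<Longrightarrow> ends (edge_point u v t) = {u, v}"
  using arcs_verts[of u v] arcs_irrefl[of u v]
  by (auto simp: ends_def edge_point_def vertex_point_def split: if_splits)

lemma ends_nonempty: "p \<in> points G \<Longrightarrow> ends p \<noteq> {}"
  by (elim points_cases) (simp_all add: ends_vertex ends_edge)

lemma ends_verts: "ends p \<subseteq> pverts G"
  by (auto simp: ends_def)

lemma vertex_point_ends:
  assumes "p \<in> points G" "ends p \<subseteq> {w}"
  shows "p = vertex_point w"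
  using assms(1)
proof (cases rule: points_cases)
  case (vertex u)
  then show ?thesis using assms(2) by (simp add: ends_vertex)
next
  case (edge u v t)
  then show ?thesis using assms(2) arcs_irrefl[of u v] by (auto simp: ends_edge)
qed

lemma edge_point_ends_ex:
  assumes "p \<in> points G" "ends p \<subseteq> {u, v}" "(u, v) \<in> parcs G"
  shows "\<exists>t\<in>{0..1}. p = edge_point u v t"
  using assms(1)
proof (cases rule: points_cases)
  case (vertex w)
  then have "w = u \<or> w = v" using assms(2) by (simp add: ends_vertex)
  then show ?thesis using vertex by (auto intro: bexI[of _ 0] bexI[of _ 1])
next
  case (edge w x t)
  then have "w = u \<and> x = v \<or> w = v \<and> x = u"
    using assms(2) arcs_irrefl[of w x] by (auto simp: ends_edge)
  then show ?thesis
  proof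
    assume "w = u \<and> x = v"
    then show ?thesis using edge by (intro bexI[of _ t]) auto
  next
    assume "w = v \<and> x = u"
    then show ?thesis using edge edge_point_flip[of v u t] by (intro bexI[of _ "1 - t"]) auto
  qed
qed

definition ternary :: "('a \<Rightarrow> real) \<Rightarrow> bool" where
  "ternary f \<longleftrightarrow> lipschitz1 f \<and> range f \<subseteq> {-1, 0, 1}"

text \<open>No edge joins a vertex of value \<open>-1\<close> to one of value \<open>1\<close>, so no cancellation takes place.\<close>

lemma ternary_nonpos_iff:
  assumes f: "ternary f" and p: "p \<in> points G"
  shows "lin_ext f p \<le> 0 \<longleftrightarrow> (\<forall>u\<in>ends p. f u \<le> 0)"
  using p
proof (cases rule: points_cases)
  case (vertex u)
  then show ?thesis by (simp add: ends_vertex lin_ext_vertex)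
next
  case (edge u v t)
  have val: "f u \<in> {-1, 0, 1}" "f v \<in> {-1, 0, 1}" using f by (auto simp: ternary_def)
  have lip: "\<bar>f u - f v\<bar> \<le> 1" using f edge by (auto simp: ternary_def lipschitz1_def)
  have "(1 - t) * f u + t * f v \<le> 0 \<longleftrightarrow> f u \<le> 0 \<and> f v \<le> 0"
    using val lip edge by auto
  then show ?thesis using edge by (simp add: ends_edge lin_ext_edge)
qed

lemma ternary_uminus: "ternary f \<Longrightarrow> ternary (\<lambda>w. - f w)"
  using lipschitz1_uminus by (fastforce simp: ternary_def)

lemma ternary_nonneg_iff:
  "ternary f \<Longrightarrow> p \<in> points G \<Longrightarrow> 0 \<le> lin_ext f p \<longleftrightarrow> (\<forall>u\<in>ends p. 0 \<le> f u)"
  using ternary_nonpos_iff[OF ternary_uminus, of f p] by (simp add: lin_ext_uminus)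

lemma ternary_zero_iff:
  "ternary f \<Longrightarrow> p \<in> points G \<Longrightarrow> lin_ext f p = 0 \<longleftrightarrow> (\<forall>u\<in>ends p. f u = 0)"
  using ternary_nonpos_iff[of f p] ternary_nonneg_iff[of f p] by (force simp: order_eq_iff)

text \<open>A point \<open>q\<close> between two points of the edge has distances to
  \<open>u\<close> and \<open>v\<close> of sum at most 1. The functions \<open>A u\<close> and
  \<open>A v\<close> are graph distances truncated at 2; their sum is 1 at \<open>u\<close> and at
  \<open>v\<close> but, for lack of a triangle, at least 3 at every other vertex.\<close>

lemma edge_convex:
  assumes uv: "(u, v) \<in> parcs G"
    and no_triangle: "\<And>w. (u, w) \<in> parcs G \<Longrightarrow> (w, v) \<in> parcs G \<Longrightarrow> False"
    and pts: "p \<in> points G" "q \<in> points G" "r \<in> points G"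
    and pr: "ends p \<subseteq> {u, v}" "ends r \<subseteq> {u, v}"
    and between: "dist p q + dist q r = dist p r"
  shows "ends q \<subseteq> {u, v}"
proof -
  have verts: "u \<in> pverts G" "v \<in> pverts G" "u \<noteq> v" using uv arcs_verts arcs_irrefl by auto
  note vp = vertex_in_points[OF verts(1)] vertex_in_points[OF verts(2)]
  obtain s t where st: "s \<in> {0..1}" "p = edge_point u v s" "t \<in> {0..1}" "r = edge_point u v t"
    using edge_point_ends_ex[OF pts(1) pr(1) uv] edge_point_ends_ex[OF pts(3) pr(2) uv] by blast
  have edge: "dist (edge_point u v x) (edge_point u v y) \<le> \<bar>x - y\<bar>"
    if "x \<in> {0..1}" "y \<in> {0..1}" for x y using dist_edge_le[OF uv that] .
  \<comment> \<open>The route \<open>u\<close>, \<open>p\<close>, \<open>q\<close>,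
    \<open>r\<close>, \<open>v\<close> has total length at most 1; for s > t the points
    \<open>p\<close> and \<open>r\<close> exchange their roles.\<close>
  have "dist (vertex_point u) q + dist (vertex_point v) q \<le> 1"
  proof (cases "s \<le> t")
    case True
    have "dist (vertex_point u) p \<le> s" "dist (vertex_point v) r \<le> 1 - t" "dist p r \<le> t - s"
      using edge[of 0 s] edge[of 1 t] edge[of s t] st True by auto
    then show ?thesis
      using dist_triangle[OF vp(1) pts(1,2)] dist_triangle[OF vp(2) pts(3,2)] between
        dist_sym[of q r] by linarith
  next
    case False
    have "dist (vertex_point u) r \<le> t" "dist (vertex_point v) p \<le> 1 - s" "dist p r \<le> s - t"
      using edge[of 0 t] edge[of 1 s] edge[of s t] st False by auto
    then show ?thesis
      using dist_triangle[OF vp(1) pts(3,2)] dist_triangle[OF vp(2) pts(1,2)] between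
        dist_sym[of q r] by linarith
  qed
  moreover define A where "A x w = (if w = x then 0 else if (x, w) \<in> parcs G then 1 else 2 :: real)"
    for x w
  have lip: "lipschitz1 (A x)" for x
    using arcs_sym by (auto simp: lipschitz1_def A_def)
  have "lin_ext (A u) q \<le> dist (vertex_point u) q" "lin_ext (A v) q \<le> dist (vertex_point v) q"
    using lin_ext_lipschitz[OF lip vp(1) pts(2), of u] lin_ext_lipschitz[OF lip vp(2) pts(2), of v]
      lin_ext_vertex[OF verts(1), of "A u"] lin_ext_vertex[OF verts(2), of "A v"]
    by (auto simp: A_def)
  ultimately have A: "lin_ext (A u) q + lin_ext (A v) q \<le> 1" by linarith
  have A1: "1 \<le> A u w + A v w" for w
    using verts(3) by (auto simp: A_def)
  have A3: "3 \<le> A u w + A v w" if "w \<notin> {u, v}" for w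
    using no_triangle[of w] that arcs_sym[of v w] by (auto simp: A_def)
  show ?thesis
    using pts(2)
  proof (cases rule: points_cases)
    case (vertex w)
    then show ?thesis using A A3[of w] by (auto simp: ends_vertex lin_ext_vertex)
  next
    case (edge w x t)
    define y z where "y = A u w + A v w" and "z = A u x + A v x"
    have yz: "(1 - t) * y + t * z \<le> 1"
      using A edge by (simp add: lin_ext_edge y_def z_def algebra_simps)
    have ge: "1 \<le> y" "1 \<le> z" using A1 by (auto simp: y_def z_def)
    have "w \<in> {u, v}"
    proof (rule ccontr)
      assume "w \<notin> {u, v}"
      then have "3 \<le> y" using A3 by (simp add: y_def)
      then have "(1 - t) * 3 \<le> (1 - t) * y" "t * 1 \<le> t * z"
        using edge ge by (intro mult_left_mono; simp)+
      from order_trans[OF add_mono[OF this] yz] show False using edge by simp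
    qed
    moreover have "x \<in> {u, v}"
    proof (rule ccontr)
      assume "x \<notin> {u, v}"
      then have "3 \<le> z" using A3 by (simp add: z_def)
      then have "(1 - t) * 1 \<le> (1 - t) * y" "t * 3 \<le> t * z"
        using edge ge by (intro mult_left_mono; simp)+
      from order_trans[OF add_mono[OF this] yz] show False using edge by simp
    qed
    ultimately show ?thesis using edge by (auto simp: ends_edge)
  qed
qed

end

text \<open>
  The path \<open>0, \<dots>, n - 1\<close> with the nested chords \<open>(a k, b k)\<close> for \<open>k < K\<close>. The vertices below \<open>a 0\<close> form
  a tail, the others a Hamiltonian cycle of the rest, which the chords cut into \<open>K\<close> cells. The
  pair \<open>(a K, b K)\<close> is an edge of the path; it only serves to treat the last cell like the others.
\<close>

locale ladder =
  fixes a b :: "nat \<Rightarrow> nat" and K n g :: nat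
  assumes K: "2 \<le> K"
    and a_less: "k < K \<Longrightarrow> a k < a (Suc k)"
    and b_less: "k < K \<Longrightarrow> b (Suc k) < b k"
    and fold: "b K = Suc (a K)"
    and top: "n = Suc (b 0)"
    and g5: "5 \<le> g"
    and g_le: "k < K \<Longrightarrow> g \<le> (a (Suc k) - a k) + (b k - b (Suc k)) + 2"
begin

text \<open>The length of the cycle around cell \<open>k\<close>: its two sides and its two
  chords.\<close>

definition len :: "nat \<Rightarrow> nat" where
  "len k = (a (Suc k) - a k) + (b k - b (Suc k)) + 2"

definition up :: "nat \<Rightarrow> nat \<Rightarrow> bool" where
  "up u v \<longleftrightarrow> v = Suc u \<or> (\<exists>k<K. u = a k \<and> v = b k)"

definition graph :: "nat pair_pre_digraph" where
  "graph = \<lparr>pverts = {..<n}, parcs = {(u, v). u < n \<and> v < n \<and> (up u v \<or> up v u)}\<rparr>"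

lemma verts_graph [simp]: "pverts graph = {..<n}"
  by (simp add: graph_def)

lemma arcs_graph: "(u, v) \<in> parcs graph \<longleftrightarrow> u < n \<and> v < n \<and> (up u v \<or> up v u)"
  by (simp add: graph_def)

lemma a_le: "i \<le> j \<Longrightarrow> j \<le> K \<Longrightarrow> a i \<le> a j"
proof (induction j)
  case (Suc j)
  then show ?case using a_less[of j] by (cases "i = Suc j") auto
qed simp

lemma b_le: "i \<le> j \<Longrightarrow> j \<le> K \<Longrightarrow> b j \<le> b i"
proof (induction j)
  case (Suc j)
  then show ?case using b_less[of j] by (cases "i = Suc j") auto
qed simp

lemma a_strict: "i < j \<Longrightarrow> j \<le> K \<Longrightarrow> a i < a j"
  using a_less[of i] a_le[of "Suc i" j] by simp

lemma b_strict: "i < j \<Longrightarrow> j \<le> K \<Longrightarrow> b j < b i"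
  using b_less[of i] b_le[of "Suc i" j] by simp

lemma a_inj: "i < K \<Longrightarrow> j < K \<Longrightarrow> a i = a j \<Longrightarrow> i = j"
  using a_strict[of i j] a_strict[of j i] by (cases i j rule: linorder_cases) auto

lemma b_inj: "i < K \<Longrightarrow> j < K \<Longrightarrow> b i = b j \<Longrightarrow> i = j"
  using b_strict[of i j] b_strict[of j i] by (cases i j rule: linorder_cases) auto

lemma a_less_b: "i \<le> K \<Longrightarrow> j \<le> K \<Longrightarrow> a i < b j"
  using a_le[of i K] b_le[of j K] fold by simp

lemma wide: "k < K \<Longrightarrow> a k + 3 \<le> b k"
  using a_strict[of k K] b_strict[of k K] fold by simp

lemma b_less_n: "k \<le> K \<Longrightarrow> b k < n"
  using b_le[of 0 k] top by simp

lemma a_less_n: "k \<le> K \<Longrightarrow> a k < n"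
  using a_less_b[of k k] b_less_n[of k] by simp

lemma up_less: "up u v \<Longrightarrow> u < v"
  using a_less_b by (auto simp: up_def)

lemma up_Suc: "up u (Suc u)"
  by (simp add: up_def)

lemma up_chord: "k < K \<Longrightarrow> up (a k) (b k)"
  by (auto simp: up_def)

lemma n_pos: "0 < n"
  by (simp add: top)

lemma linked0: "v < n \<Longrightarrow> (0, v) \<in> (parcs graph)\<^sup>*"
proof (induction v)
  case (Suc v)
  have "(v, Suc v) \<in> parcs graph" using Suc.prems by (simp add: arcs_graph up_Suc)
  then show ?case using Suc by (meson Suc_lessD rtrancl.rtrancl_into_rtrancl)
qed simp

sublocale conn_graph graph
proof
  fix u v :: nat
  have "sym (parcs graph)" by (auto simp: sym_def arcs_graph)
  then have sym: "sym ((parcs graph)\<^sup>*)" by (rule sym_rtrancl)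
  assume "u \<in> pverts graph" "v \<in> pverts graph"
  then have "(0, u) \<in> (parcs graph)\<^sup>*" "(0, v) \<in> (parcs graph)\<^sup>*" using linked0 by auto
  then show "(u, v) \<in> (parcs graph)\<^sup>*" using sym by (meson rtrancl_trans symE)
qed (use n_pos in \<open>auto simp: arcs_graph dest: up_less\<close>)

lemma arc_chord: "k < K \<Longrightarrow> (a k, b k) \<in> parcs graph"
  using a_less_n[of k] b_less_n[of k] up_chord by (simp add: arcs_graph)

lemma arc_Suc: "Suc u < n \<Longrightarrow> (u, Suc u) \<in> parcs graph"
  by (simp add: arcs_graph up_Suc)

text \<open>Applied at the least vertex of a cycle, whose neighbours both lie above it;
  \<open>up_two'\<close> is the mirror image for the greatest vertex.\<close>

lemma up_two:
  assumes "up u v" "up u w" "v \<noteq> w"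
  obtains k where "k < K" "u = a k" "{v, w} = {Suc u, b k}"
proof -
  from assms(1,2) consider "v = Suc u" "w = Suc u"
    | k where "v = Suc u" "k < K" "u = a k" "w = b k"
    | k where "w = Suc u" "k < K" "u = a k" "v = b k"
    | i j where "i < K" "j < K" "u = a i" "u = a j" "v = b i" "w = b j"
    unfolding up_def by blast
  then show thesis
  proof cases
    case (4 i j)
    then show ?thesis using a_inj[of i j] assms(3) by simp
  qed (use that assms(3) in \<open>auto simp: insert_commute\<close>)
qed

lemma up_two':
  assumes "up v u" "up w u" "v \<noteq> w"
  obtains k where "k < K" "u = b k" "{v, w} = {u - 1, a k}"
proof -
  from assms(1,2) consider "u = Suc v" "u = Suc w"
    | k where "u = Suc v" "k < K" "u = b k" "w = a k"
    | k where "u = Suc w" "k < K" "u = b k" "v = a k"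
    | i j where "i < K" "j < K" "u = b i" "u = b j" "v = a i" "w = a j"
    unfolding up_def by blast
  then show thesis
  proof cases
    case (2 k)
    then have "{v, w} = {u - 1, a k}" by simp
    then show ?thesis using that 2 by blast
  next
    case (3 k)
    then have "{v, w} = {u - 1, a k}" by auto
    then show ?thesis using that 3 by blast
  next
    case (4 i j)
    then show ?thesis using b_inj[of i j] assms(3) by simp
  qed (use assms(3) in simp)
qed

section \<open>Cycles of a ladder\<close>

text \<open>The closing edge is chord \<open>k\<close>. For k = 0 this is the Hamiltonian cycle of
  the part without tail, for k = K - 1 the boundary of the innermost cell; they realise
  circumference and girth.\<close>

lemma contiguous_cycle:
  assumes "k < K"
  shows "is_cycle graph (\<lambda>i. a k + i) (b k - a k + 1)"
  unfolding is_cycle_def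
proof (intro conjI allI impI)
  fix i assume i: "i < b k - a k + 1"
  show "(a k + i, a k + Suc i mod (b k - a k + 1)) \<in> parcs graph"
  proof (cases "i = b k - a k")
    case True
    then show ?thesis using arcs_sym[OF arc_chord[OF assms]] a_less_b[of k k] assms by simp
  next
    case False
    then show ?thesis using i arc_Suc[of "a k + i"] b_less_n[of k] assms by simp
  qed
qed (use wide[OF assms] in auto)

text \<open>
  The potential grows along the sides of the cell and across its inner chord, and is constant
  beyond that chord; hence a path between the ends of the outer chord is as long as the cell.
\<close>

lemma cell_detour:
  assumes k: "k < K" and m: "3 \<le> m" and inj: "inj_on h {..<m}"
    and arcs: "\<And>x. Suc x < m \<Longrightarrow> (h x, h (Suc x)) \<in> parcs graph"
    and ends: "h 0 = a k" "h (m - 1) = b k"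
    and range: "\<And>x. x < m \<Longrightarrow> a k \<le> h x \<and> h x \<le> b k"
  shows "len k \<le> m"
proof -
  define \<phi> where "\<phi> v = (if v \<le> a (Suc k) then int v - a k
    else if v < b (Suc k) then int (a (Suc k)) - a k
    else int (a (Suc k)) - a k + 1 + (int v - b (Suc k)))" for v
  have ord: "a k < a (Suc k)" "a (Suc k) < b (Suc k)" "b (Suc k) < b k"
    using a_less b_less a_less_b k by auto
  have up_lip: "\<bar>\<phi> v - \<phi> u\<bar> \<le> 1"
    if uv: "up u v" "a k \<le> u" "v \<le> b k" "\<not> (u = a k \<and> v = b k)" for u v
    using uv(1) unfolding up_def
  proof
    assume "v = Suc u"
    then show ?thesis using ord by (auto simp: \<phi>_def)
  next
    assume "\<exists>j<K. u = a j \<and> v = b j"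
    then obtain j where j: "j < K" "u = a j" "v = b j" by blast
    have "k < j"
    proof (rule ccontr)
      assume "\<not> k < j"
      then have "j < k \<or> j = k" by linarith
      then show False using a_strict[of j k] k uv j by auto
    qed
    then consider "j = Suc k" | "Suc k < j" by linarith
    then show ?thesis
    proof cases
      case 1
      then show ?thesis using ord j by (auto simp: \<phi>_def)
    next
      case 2
      then have "a (Suc k) < u" "v < b (Suc k)" "u < b (Suc k)" "a (Suc k) < v"
        using j a_strict[of "Suc k" j] b_strict[of "Suc k" j] a_less_b[of j "Suc k"]
          a_less_b[of "Suc k" j] k by auto
      then show ?thesis by (simp add: \<phi>_def)
    qed
  qed
  have step: "\<phi> (h (Suc x)) \<le> \<phi> (h x) + 1" if "Suc x < m" for x
  proof -
    have eq: "y = z" if "h y = h z" "y < m" "z < m" for y z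
      using inj_onD[OF inj that(1)] that by simp
    \<comment> \<open>The ends of the outer chord are \<open>h 0\<close> and
      \<open>h (m - 1)\<close>, which are not consecutive since 3 \<le> m; injectivity keeps them
      from recurring.\<close>
    have no: "\<not> (h x = a k \<and> h (Suc x) = b k)" "\<not> (h (Suc x) = a k \<and> h x = b k)"
      using eq[of x 0] eq[of "Suc x" "m - 1"] eq[of "Suc x" 0] ends m that by auto
    have "up (h x) (h (Suc x)) \<or> up (h (Suc x)) (h x)" using arcs[OF that] by (simp add: arcs_graph)
    then show ?thesis
      using up_lip[of "h x" "h (Suc x)"] up_lip[of "h (Suc x)" "h x"] range[of x] range[of "Suc x"]
        that no by auto
  qed
  have "\<phi> (h x) \<le> \<phi> (h 0) + int x" if "x < m" for x
    using that
  proof (induction x)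
    case (Suc x)
    then show ?case using step[of x] by simp
  qed simp
  from this[of "m - 1"] have "\<phi> (b k) \<le> \<phi> (a k) + int (m - 1)" using m ends by simp
  moreover have "\<phi> (a k) = 0" using ord by (simp add: \<phi>_def)
  moreover have "\<phi> (b k) = int (len k) - 1" using ord by (simp add: \<phi>_def len_def)
  ultimately show ?thesis using m by linarith
qed

text \<open>The least vertex of a cycle has two upper neighbours, so it is some \<open>a k\<close>
  and the cycle uses chord \<open>k\<close>. The greatest vertex is some \<open>b k'\<close> with k
  \<le> k', so the rest of the cycle runs between \<open>a k\<close> and \<open>b k\<close> and
  \<open>cell_detour\<close> applies to it.\<close>

lemma cycle_bounds:
  assumes "is_cycle graph c m"
  shows "g \<le> m" "m \<le> n - a 0"
proof -
  have c: "3 \<le> m" "inj_on c {..<m}" "\<And>i. i < m \<Longrightarrow> (c i, c (Suc i mod m)) \<in> parcs graph"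
    using assms by (auto simp: is_cycle_def)
  define f where "f = cyc c m"
  have arc: "(f i, f (i + 1)) \<in> parcs graph" for i unfolding f_def using c by (intro cyc_arc) auto
  have inj: "i = j" if "f i = f j" "\<bar>i - j\<bar> < int m" for i j
    using cyc_inj[OF c(2)] that unfolding f_def by blast
  have per: "f (i + int m) = f i" for i by (simp add: f_def cyc_periodic)
  have arc': "(f i, f (i - 1)) \<in> parcs graph" for i using arcs_sym[OF arc[of "i - 1"]] by simp
  have nb: "f (i + 1) \<noteq> f (i - 1)" "f (i + 1) \<noteq> f i" "f (i - 1) \<noteq> f i" for i
    using inj[of "i + 1" "i - 1"] inj[of "i + 1" i] inj[of "i - 1" i] c(1) by auto
  have range: "range f \<subseteq> c ` {..<m}"
  proof
    fix y assume "y \<in> range f"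
    then obtain i where "y = c (nat (i mod int m))" by (auto simp: f_def cyc_def)
    moreover have "0 \<le> i mod int m" "i mod int m < int m" using c(1) by auto
    ultimately show "y \<in> c ` {..<m}" by auto
  qed
  have range': "c ` {..<m} \<subseteq> range f"
    using cyc_of_nat[of _ m c] unfolding f_def by (metis image_subsetI lessThan_iff rangeI)
  have fin: "finite (range f)" "range f \<noteq> {}" using finite_subset[OF range] by auto
  obtain i where i: "f i = Min (range f)" using Min_in[OF fin] by (metis imageE)
  then have min: "f i \<le> f j" for j using fin by simp
  have up: "up (f i) (f (i + 1))" "up (f i) (f (i - 1))"
    using arc[of i] arc'[of i] min[of "i + 1"] min[of "i - 1"] up_less
    by (force simp: arcs_graph)+
  from up_two[OF up nb(1)] obtain k where k: "k < K" "f i = a k"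
    "{f (i + 1), f (i - 1)} = {Suc (f i), b k}" by metis
  obtain j where j: "f j = Max (range f)" using Max_in[OF fin] by (metis imageE)
  then have max: "f x \<le> f j" for x using fin by simp
  have up': "up (f (j + 1)) (f j)" "up (f (j - 1)) (f j)"
    using arc[of j] arc'[of j] max[of "j + 1"] max[of "j - 1"] up_less
    by (force simp: arcs_graph)+
  from up_two'[OF up' nb(1)] obtain k' where k': "k' < K" "f j = b k'"
    "{f (j + 1), f (j - 1)} = {f j - 1, a k'}" by metis
  \<comment> \<open>\<open>a k'\<close> is a neighbour of the greatest vertex on the cycle, so
    minimality of \<open>a k\<close> gives k \<le> k'.\<close>
  have "a k' \<in> range f" using k'(3) by (metis insertI1 insertI2 insertE rangeI singletonD)
  then have "a k \<le> a k'" using min k(2) by auto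
  then have "k \<le> k'" using a_strict[of k' k] k(1) k'(1) by (meson leI less_imp_le not_less)
  then have "f j \<le> b k" using b_le[of k k'] k'(1,2) by simp
  then have rng: "a k \<le> f x \<and> f x \<le> b k" for x using min[of x] max[of x] k(2) by simp
  have "m \<le> card {a 0..<n}"
  proof -
    have "c ` {..<m} \<subseteq> {a 0..<n}"
    proof
      fix y assume "y \<in> c ` {..<m}"
      then obtain x where "y = f x" using range' by blast
      then show "y \<in> {a 0..<n}"
        using rng[of x] a_le[of 0 k] b_less_n[of k] k(1) by simp
    qed
    then have "card (c ` {..<m}) \<le> card {a 0..<n}" by (intro card_mono) auto
    then show ?thesis using card_image[OF c(2)] by simp
  qed
  then show "m \<le> n - a 0" by simp
  \<comment> \<open>Starting at \<open>a k\<close>, the cycle is read in the direction that makes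
    chord \<open>k\<close> its closing edge.\<close>
  have "len k \<le> m"
  proof (cases "f (i - 1) = b k")
    case True
    show ?thesis
    proof (rule cell_detour[OF k(1) c(1), of "\<lambda>x. f (i + int x)"])
      show "inj_on (\<lambda>x. f (i + int x)) {..<m}" by (rule inj_onI) (auto dest!: inj)
      show "f (i + int (m - 1)) = b k" using True per[of "i - 1"] c(1) by (simp add: algebra_simps)
      show "(f (i + int x), f (i + int (Suc x))) \<in> parcs graph" for x
        using arc[of "i + int x"] by (simp add: algebra_simps)
    qed (use k rng in auto)
  next
    case False
    then have b: "f (i + 1) = b k" using k(3) by (auto simp: doubleton_eq_iff)
    show ?thesis
    proof (rule cell_detour[OF k(1) c(1), of "\<lambda>x. f (i - int x)"])
      show "inj_on (\<lambda>x. f (i - int x)) {..<m}" by (rule inj_onI) (auto dest!: inj)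
      show "f (i - int (m - 1)) = b k"
        using b per[of "i - int (m - 1)"] c(1) by (simp add: algebra_simps)
      show "(f (i - int x), f (i - int (Suc x))) \<in> parcs graph" for x
        using arc'[of "i - int x"] by (simp add: algebra_simps)
    qed (use k rng in auto)
  qed
  then show "g \<le> m" using g_le[OF k(1)] by (simp add: len_def)
qed

lemma girth_graph:
  assumes "len (K - 1) = g"
  shows "girth graph = enat g"
proof (rule girth_eqI)
  have "b (K - 1) - a (K - 1) + 1 = g"
    using assms fold a_less[of "K - 1"] b_less[of "K - 1"] K by (simp add: len_def)
  then show "is_cycle graph (\<lambda>i. a (K - 1) + i) g"
    using contiguous_cycle[of "K - 1"] K by simp
qed (rule cycle_bounds)

lemma circumference_graph: "circumference graph = enat (n - a 0)"
proof (rule circumference_eqI)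
  have "b 0 - a 0 + 1 = n - a 0" using top a_less_b[of 0 0] by simp
  then show "is_cycle graph (\<lambda>i. a 0 + i) (n - a 0)" using contiguous_cycle[of 0] K by simp
qed (rule cycle_bounds)

end

context ladder
begin

section \<open>Gates of a ladder\<close>

definition cut :: "nat \<Rightarrow> nat \<Rightarrow> real" where
  "cut t v = (if v < t then -1 else if v = t then 0 else 1)"

definition chord :: "nat \<Rightarrow> nat \<Rightarrow> real" where
  "chord k v = (if v = a k \<or> v = b k then 0 else if a k < v \<and> v < b k then 1 else -1)"

text \<open>The first cell begins at the single vertex \<open>a 0\<close>, a gate of diameter 0, so
  chord 0 is not made a gate. The last function is constantly -1, an empty gate that gives the last
  cell the form of the others. Hence only inner cells lie between two gates of diameter 1.\<close>

definition gate :: "nat \<Rightarrow> nat \<Rightarrow> real" where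
  "gate i = (if i \<le> a 0 then cut i else if i < a 0 + K then chord (i - a 0) else (\<lambda>_. -1))"

definition gate_size :: "nat \<Rightarrow> real" where
  "gate_size i = (if a 0 < i \<and> i < a 0 + K then 1 else 0)"

definition cell_size :: "nat \<Rightarrow> real" where
  "cell_size i = (if i < a 0 then 1 else real (len (i - a 0)) / 2)"

lemma ternaryI:
  assumes "range f \<subseteq> {-1, 0, 1}" "\<And>u v. up u v \<Longrightarrow> \<bar>f u - f v\<bar> \<le> 1"
  shows "ternary f"
proof -
  have "\<bar>f u - f v\<bar> \<le> 1" if "(u, v) \<in> parcs graph" for u v
    using that assms(2)[of u v] assms(2)[of v u] by (auto simp: arcs_graph abs_minus_commute)
  then show ?thesis using assms(1) by (auto simp: ternary_def lipschitz1_def)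
qed

lemma ternary_cut: "t \<le> a 0 \<Longrightarrow> ternary (cut t)"
proof (rule ternaryI)
  fix u v assume t: "t \<le> a 0" and "up u v"
  then show "\<bar>cut t u - cut t v\<bar> \<le> 1"
    unfolding up_def
  proof (elim disjE exE conjE)
    fix k assume "k < K" "u = a k" "v = b k"
    then have "t \<le> u" "t < v" using t a_le[of 0 k] a_less_b[of k k] by auto
    then show ?thesis by (simp add: cut_def)
  qed (auto simp: cut_def)
qed (auto simp: cut_def)

lemma ternary_chord:
  assumes k: "k < K"
  shows "ternary (chord k)"
proof (rule ternaryI)
  fix u v assume "up u v"
  then show "\<bar>chord k u - chord k v\<bar> \<le> 1"
    unfolding up_def
  proof (elim disjE exE conjE)
    fix j assume j: "j < K" "u = a j" "v = b j"
    consider "j < k" | "j = k" | "k < j" by linarith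
    then show ?thesis
    proof cases
      case 1
      then have "u < a k" "b k < v" using j k a_strict b_strict by auto
      then show ?thesis using a_less_b[of k k] k by (auto simp: chord_def)
    next
      case 3
      then have "a k < u" "v < b k" "u < b k" "a k < v"
        using j k a_strict b_strict a_less_b[of j k] a_less_b[of k j] by auto
      then show ?thesis by (auto simp: chord_def)
    qed (use j in \<open>auto simp: chord_def\<close>)
  qed (use wide[OF k] in \<open>auto simp: chord_def\<close>)
qed (auto simp: chord_def)

lemma ternary_gate: "ternary (gate i)"
proof -
  have "ternary (\<lambda>_. -1)" by (rule ternaryI) auto
  then show ?thesis using ternary_cut[of i] ternary_chord[of "i - a 0"] by (auto simp: gate_def)
qed

lemma gate_chord: "0 < k \<Longrightarrow> k < K \<Longrightarrow> gate (a 0 + k) = chord k"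
  by (simp add: gate_def)

lemma gate_nested_vertex:
  assumes i: "i < a 0 + K" and u: "u < n" "0 \<le> gate (Suc i) u"
  shows "0 < gate i u"
proof -
  consider "Suc i \<le> a 0" | k where "i = a 0 + k" "Suc k < K" | "Suc i = a 0 + K"
    using i by (metis add_Suc_right le_add_diff_inverse nat_add_left_cancel_less nat_less_le not_less_eq_eq Suc_leI)
  then show ?thesis
  proof cases
    case 1
    then show ?thesis using u by (simp add: gate_def cut_def split: if_splits)
  next
    case (2 k)
    then have "0 \<le> chord (Suc k) u" using u(2) gate_chord[of "Suc k"] by simp
    then have "a (Suc k) \<le> u" "u \<le> b (Suc k)"
      using a_less_b[of "Suc k" "Suc k"] 2 by (auto simp: chord_def split: if_splits)
    then have "a k < u" "u < b k" using a_less[of k] b_less[of k] 2 by auto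
    then show ?thesis using 2 gate_chord[of k]
      by (cases "k = 0") (simp_all add: gate_def cut_def chord_def)
  next
    case 3
    then have "gate (Suc i) u = -1" using K by (simp add: gate_def)
    then show ?thesis using u by simp
  qed
qed

lemma chord_zero_ends:
  assumes "k < K" "p \<in> points graph" "lin_ext (chord k) p = 0"
  shows "ends p \<subseteq> {a k, b k}"
  using assms(3) ternary_zero_iff[OF ternary_chord[OF assms(1)] assms(2)]
  by (auto simp: chord_def split: if_splits)

lemma cut_zero:
  assumes "t \<le> a 0" "p \<in> points graph" "lin_ext (cut t) p = 0"
  shows "p = vertex_point t"
proof (rule vertex_point_ends[OF assms(2)])
  show "ends p \<subseteq> {t}"
    using assms(3) ternary_zero_iff[OF ternary_cut[OF assms(1)] assms(2)]
    by (auto simp: cut_def split: if_splits)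
qed

text \<open>Apart from the chord, \<open>a k\<close> has only its path successor above it and
  \<open>b k\<close> only its path predecessor below it; \<open>wide\<close> keeps these
  apart.\<close>

lemma chord_no_triangle:
  assumes k: "k < K" and w: "(a k, w) \<in> parcs graph" "(w, b k) \<in> parcs graph"
  shows False
proof -
  have "w \<noteq> a k" "w \<noteq> b k" using w arcs_irrefl by auto
  then have above: "up (a k) w \<Longrightarrow> w = Suc (a k)" and below: "up w (b k) \<Longrightarrow> Suc w = b k"
    using a_inj[OF _ k] b_inj[OF _ k] by (auto simp: up_def)
  consider "up (a k) w" "up w (b k)" | "up (a k) w" "up (b k) w" | "up w (a k)" "up w (b k)"
  proof -
    have "\<not> (up w (a k) \<and> up (b k) w)"
      using up_less[of w "a k"] up_less[of "b k" w] a_less_b[of k k] k by auto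
    then show thesis using that w by (auto simp: arcs_graph)
  qed
  then show False
  proof cases
    case 1
    then show False using above below wide[OF k] by simp
  next
    case 2
    then show False using above wide[OF k] up_less[of "b k" w] by simp
  next
    case 3
    then show False using below wide[OF k] up_less[of w "a k"] by simp
  qed
qed

section \<open>Cells of a ladder\<close>

definition cell_verts :: "nat \<Rightarrow> nat set" where
  "cell_verts k = {a k..a (Suc k)} \<union> {b (Suc k)..b k}"

text \<open>A cyclic numbering of the cell: up one side, across the inner chord, up the other side
  to \<open>b k\<close>; the closing edge is chord \<open>k\<close>.\<close>

definition rim :: "nat \<Rightarrow> nat \<Rightarrow> nat" where
  "rim k j = (if j \<le> a (Suc k) - a k then a k + j else b (Suc k) + (j - (a (Suc k) - a k) - 1))"

context
  fixes k assumes k: "k < K"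
begin

lemma ord: "a k < a (Suc k)" "a (Suc k) < b (Suc k)" "b (Suc k) < b k" "b k < n"
  using k a_less b_less a_less_b[of "Suc k" "Suc k"] b_less_n[of k] by auto

lemma sides:
  obtains x y where "a (Suc k) = a k + x" "b k = b (Suc k) + y" "0 < x" "0 < y" "len k = x + y + 2"
    "\<And>j. rim k j = (if j \<le> x then a k + j else b (Suc k) + (j - x - 1))"
  using that[of "a (Suc k) - a k" "b k - b (Suc k)"] ord by (simp add: len_def rim_def)

lemma inner_chord: "(a (Suc k), b (Suc k)) \<in> parcs graph"
proof (cases "Suc k < K")
  case True
  then show ?thesis by (rule arc_chord)
next
  case False
  then have "Suc k = K" using k by simp
  then show ?thesis using fold arc_Suc[of "a K"] b_less_n[of K] by simp
qed

lemma rim_arc: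
  assumes "j < len k"
  shows "(rim k j, rim k (Suc j mod len k)) \<in> parcs graph"
proof -
  obtain x y where xy: "a (Suc k) = a k + x" "b k = b (Suc k) + y" "0 < x" "0 < y"
    "len k = x + y + 2" and rim: "\<And>j. rim k j = (if j \<le> x then a k + j else b (Suc k) + (j - x - 1))"
    using sides by blast
  consider "j < x" | "j = x" | "x < j" "j < x + y + 1" | "j = x + y + 1"
    using assms xy(5) by linarith
  then show ?thesis
  proof cases
    case 1
    then show ?thesis using rim xy arc_Suc[of "a k + j"] ord by simp
  next
    case 2
    then show ?thesis using rim xy inner_chord by simp
  next
    case 3
    obtain i where i: "j = x + 1 + i" using less_iff_Suc_add[of x j] 3 by auto
    then have "i < y" using 3 by simp
    then show ?thesis using i rim xy arc_Suc[of "b (Suc k) + i"] ord by simp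
  next
    case 4
    then show ?thesis using rim xy arcs_sym[OF arc_chord[OF k]] by simp
  qed
qed

lemma rim_vertex:
  assumes "w \<in> cell_verts k"
  shows "\<exists>j<len k. w = rim k j"
proof -
  obtain x y where xy: "a (Suc k) = a k + x" "b k = b (Suc k) + y" "0 < x" "0 < y"
    "len k = x + y + 2" and rim: "\<And>j. rim k j = (if j \<le> x then a k + j else b (Suc k) + (j - x - 1))"
    using sides by blast
  show ?thesis
  proof (cases "w \<le> a (Suc k)")
    case True
    then show ?thesis using assms ord xy rim
      by (intro exI[of _ "w - a k"]) (auto simp: cell_verts_def)
  next
    case False
    then show ?thesis using assms ord xy rim
      by (intro exI[of _ "x + 1 + (w - b (Suc k))"]) (auto simp: cell_verts_def)
  qed
qed

lemma rim_edge:
  assumes w: "w \<in> cell_verts k" "v \<in> cell_verts k" "up w v"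
  shows "\<exists>j<len k. {w, v} = {rim k j, rim k (Suc j mod len k)}"
proof -
  obtain x y where xy: "a (Suc k) = a k + x" "b k = b (Suc k) + y" "0 < x" "0 < y"
    "len k = x + y + 2" and rim: "\<And>j. rim k j = (if j \<le> x then a k + j else b (Suc k) + (j - x - 1))"
    using sides by blast
  from w(3) show ?thesis
    unfolding up_def
  proof (elim disjE exE conjE)
    assume v: "v = Suc w"
    consider "a k \<le> w" "w < a (Suc k)" | "w = a (Suc k)" | "b (Suc k) \<le> w" "w < b k"
      using w v ord by (auto simp: cell_verts_def)
    then show ?thesis
    proof cases
      case 1
      then show ?thesis using v rim xy by (intro exI[of _ "w - a k"]) auto
    next
      case 2
      then have "v = b (Suc k)" using w v ord by (auto simp: cell_verts_def)
      then show ?thesis using 2 rim xy by (intro exI[of _ x]) auto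
    next
      case 3
      then obtain i where "w = b (Suc k) + i" "i < y" using xy by (auto simp: le_iff_add)
      then show ?thesis using v rim xy by (intro exI[of _ "x + 1 + i"]) auto
    qed
  next
    fix j assume j: "j < K" "w = a j" "v = b j"
    have "a j \<le> a (Suc k)" "a k \<le> a j"
      using w(1) j ord a_less_b[of j "Suc k"] k by (auto simp: cell_verts_def)
    then have "j \<le> Suc k" "k \<le> j" using a_strict[of "Suc k" j] a_strict[of j k] j k
      by (auto simp: not_less[symmetric])
    then consider "j = k" | "j = Suc k" by linarith
    then show ?thesis
    proof cases
      case 1
      then show ?thesis using j rim xy by (intro exI[of _ "x + y + 1"]) auto
    next
      case 2
      then show ?thesis using j rim xy by (intro exI[of _ x]) auto
    qed
  qed
qed

abbreviation rim_curve :: "real \<Rightarrow> nat point" where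
  "rim_curve \<equiv> curve (cyc (rim k) (len k))"

lemma rim_curve_arc: "(cyc (rim k) (len k) i, cyc (rim k) (len k) (i + 1)) \<in> parcs graph"
  by (rule cyc_arc, simp add: len_def, rule rim_arc)

lemma rim_curve_point:
  assumes j: "j < len k" and t: "0 \<le> t" "t \<le> 1"
  shows "rim_curve (real j + t) = edge_point (rim k j) (rim k (Suc j mod len k)) t"
proof -
  have "cyc (rim k) (len k) (int j + 1) = rim k (Suc j mod len k)"
    by (simp add: cyc_def nat_mod_distrib nat_add_distrib)
  then show ?thesis
    using curve_edge[OF t, of "cyc (rim k) (len k)" "int j"] cyc_of_nat[OF j, of "rim k"] by simp
qed

lemma cell_curve:
  assumes p: "p \<in> points graph" "ends p \<subseteq> cell_verts k"
  shows "\<exists>r\<in>{0..real (len k)}. p = rim_curve r"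
proof -
  have segment: "\<exists>r\<in>{0..real (len k)}. edge_point w v t = rim_curve r"
    if "up w v" "w \<in> cell_verts k" "v \<in> cell_verts k" "0 < t" "t < 1" for w v t
  proof -
    from rim_edge[OF that(2,3,1)]
    obtain j where j: "j < len k" "{w, v} = {rim k j, rim k (Suc j mod len k)}" by blast
    from j(2) consider "w = rim k j" "v = rim k (Suc j mod len k)"
      | "v = rim k j" "w = rim k (Suc j mod len k)" by (auto simp: doubleton_eq_iff)
    then show ?thesis
    proof cases
      case 1
      then show ?thesis using rim_curve_point[OF j(1), of t] that j(1)
        by (intro bexI[of _ "real j + t"]) auto
    next
      case 2
      then show ?thesis using rim_curve_point[OF j(1), of "1 - t"] that j(1) edge_point_flip[of w v t]
        by (intro bexI[of _ "real j + (1 - t)"]) auto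
    qed
  qed
  from p(1) show ?thesis
  proof (cases rule: points_cases)
    case (vertex u)
    then obtain j where "j < len k" "u = rim k j" using p(2) rim_vertex by (auto simp: ends_vertex)
    then show ?thesis using vertex rim_curve_point[of j 0]
      by (intro bexI[of _ "real j"]) auto
  next
    case (edge u v t)
    then have uv: "u \<in> cell_verts k" "v \<in> cell_verts k" "up u v \<or> up v u"
      using p(2) by (auto simp: ends_edge arcs_graph)
    from uv(3) show ?thesis
    proof
      assume "up v u"
      from segment[OF this uv(2,1), of "1 - t"] show ?thesis
        using edge_point_flip[of u v t] edge(2-4) by simp
    next
      assume "up u v"
      from segment[OF this uv(1,2) edge(2,3)] show ?thesis using edge(4) by simp
    qed
  qed
qed

lemma cell_dist:
  assumes "p \<in> points graph" "ends p \<subseteq> cell_verts k" "q \<in> points graph" "ends q \<subseteq> cell_verts k"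
  shows "dist p q \<le> real (len k) / 2"
proof -
  obtain r s where rs: "r \<in> {0..real (len k)}" "p = rim_curve r" "s \<in> {0..real (len k)}" "q = rim_curve s"
    using cell_curve assms by metis
  have "dist (rim_curve r) (rim_curve s) \<le> of_int (int (len k)) / 2"
    by (rule closed_curve_dist[OF rim_curve_arc cyc_periodic]) (use rs in auto)
  then show ?thesis using rs by simp
qed

lemma cell_ends:
  assumes p: "p \<in> points graph" "0 \<le> lin_ext (gate (a 0 + k)) p" "lin_ext (gate (Suc (a 0 + k))) p \<le> 0"
  shows "ends p \<subseteq> cell_verts k"
proof
  fix u assume u: "u \<in> ends p"
  have un: "u < n" using u ends_verts by auto
  have lo: "0 \<le> gate (a 0 + k) u"
    using p u ternary_nonneg_iff[OF ternary_gate] by blast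
  have hi: "gate (a 0 + Suc k) u \<le> 0"
    using p u ternary_nonpos_iff[OF ternary_gate] by simp
  have outer: "a k \<le> u \<and> u \<le> b k"
  proof (cases "k = 0")
    case True
    then show ?thesis using lo un top by (simp add: gate_def cut_def split: if_splits)
  next
    case False
    then show ?thesis using lo k gate_chord[of k] a_less_b[of k k]
      by (auto simp: chord_def split: if_splits)
  qed
  have inner: "u \<le> a (Suc k) \<or> b (Suc k) \<le> u"
  proof (cases "Suc k < K")
    case True
    then show ?thesis using hi gate_chord[of "Suc k"] by (auto simp: chord_def split: if_splits)
  next
    \<comment> \<open>The last gate is empty, but \<open>fold\<close> leaves no vertex between
      \<open>a K\<close> and \<open>b K\<close>.\<close>
    case False
    then have "Suc k = K" using k by simp
    then show ?thesis using fold by auto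
  qed
  show "u \<in> cell_verts k" using outer inner by (auto simp: cell_verts_def)
qed

lemma chord_near_ends:
  assumes "w \<in> points graph" "lin_ext (chord k) w = 0"
  shows "dist (vertex_point (a k)) w \<le> 1" "dist (vertex_point (b k)) w \<le> 1"
proof -
  obtain t where "t \<in> {0..1}" "w = edge_point (a k) (b k) t"
    using edge_point_ends_ex[OF assms(1) chord_zero_ends[OF k assms] arc_chord[OF k]] by blast
  then show "dist (vertex_point (a k)) w \<le> 1" "dist (vertex_point (b k)) w \<le> 1"
    using dist_edge_le[OF arc_chord[OF k], of 0 t] dist_edge_le[OF arc_chord[OF k], of 1 t] by auto
qed

end

lemma chord_diameter:
  assumes k: "k < K" and p: "p \<in> points graph" "ends p \<subseteq> {a k, b k}"
    and q: "q \<in> points graph" "ends q \<subseteq> {a k, b k}"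
  shows "dist p q \<le> 1"
proof -
  obtain s t where "s \<in> {0..1}" "p = edge_point (a k) (b k) s" "t \<in> {0..1}" "q = edge_point (a k) (b k) t"
    using edge_point_ends_ex[OF p arc_chord[OF k]] edge_point_ends_ex[OF q arc_chord[OF k]] by blast
  then show ?thesis using dist_edge_le[OF arc_chord[OF k], of s t] by auto
qed

text \<open>
  In an inner cell a point of a side is within half the length of the side from one of the two
  chords, and a further unit leads to any point of that chord.
\<close>

lemma inner_cell_near:
  assumes k: "0 < k" "Suc k < K" and D: "1 \<le> D"
    "real (a (Suc k) - a k) + 2 \<le> 2 * D" "real (b k - b (Suc k)) + 2 \<le> 2 * D"
    and p: "p \<in> points graph" "ends p \<subseteq> cell_verts k"
  shows "(\<forall>w\<in>points graph. lin_ext (chord k) w = 0 \<longrightarrow> dist p w \<le> D) \<or>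
    (\<forall>w\<in>points graph. lin_ext (chord (Suc k)) w = 0 \<longrightarrow> dist p w \<le> D)"
proof -
  have kK: "k < K" using k by simp
  obtain x y where xy: "a (Suc k) = a k + x" "b k = b (Suc k) + y" "0 < x" "0 < y"
    "len k = x + y + 2" and rim: "\<And>j. rim k j = (if j \<le> x then a k + j else b (Suc k) + (j - x - 1))"
    using sides[OF kK] by blast
  obtain r where r: "0 \<le> r" "r \<le> real (len k)" "p = rim_curve k r"
    using cell_curve[OF kK p] by auto
  have at: "rim_curve k (real j) = vertex_point (rim k j)" if "j < len k" for j
    using rim_curve_point[OF kK that, of 0] by simp
  have at_end: "rim_curve k (real (x + y + 2)) = vertex_point (a k)"
    using curve_periodic[of "cyc (rim k) (len k)" "int (len k)" 0, OF cyc_periodic] at[of 0] xy(5) rim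
    by simp
  note at' = at[of 0] at[of x] at[of "x + 1"] at[of "x + y + 1"]
  note lip = curve_lipschitz[of "cyc (rim k) (len k)", OF rim_curve_arc[OF kK]]
  have near: "\<forall>w\<in>points graph. lin_ext (chord j) w = 0 \<longrightarrow> dist p w \<le> D"
    if j: "j = k \<or> j = Suc k" and v: "v = a j \<or> v = b j" "dist p (vertex_point v) + 1 \<le> D" for j v
  proof (intro ballI impI)
    fix w assume w: "w \<in> points graph" "lin_ext (chord j) w = 0"
    have jK: "j < K" using j k by auto
    have "vertex_point v \<in> points graph"
      using v(1) jK a_less_n[of j] b_less_n[of j] by (auto intro: vertex_in_points)
    then show "dist p w \<le> D"
      using dist_triangle[OF p(1), of "vertex_point v" w] w(1) chord_near_ends[OF jK w] v by auto
  qed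
  \<comment> \<open>The four stretches of the rim: a side, the inner chord, the other side, the
    outer chord.\<close>
  consider (top) "r \<le> x" | (inner) "x \<le> r" "r \<le> x + 1" | (bottom) "x + 1 \<le> r" "r \<le> x + y + 1"
    | (outer) "x + y + 1 \<le> r" by linarith
  then show ?thesis
  proof cases
    case top
    have "dist p (vertex_point (a k)) \<le> r" "dist p (vertex_point (a (Suc k))) \<le> x - r"
      using lip[of 0 r] lip[of r "real x"] r top at' rim xy dist_sym by auto
    then have "dist p (vertex_point (a k)) + 1 \<le> D \<or> dist p (vertex_point (a (Suc k))) + 1 \<le> D"
      using D(2) xy by auto
    then show ?thesis using near by blast
  next
    case bottom
    have "dist p (vertex_point (b (Suc k))) \<le> r - (x + 1)" "dist p (vertex_point (b k)) \<le> x + y + 1 - r"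
      using lip[of "real (x + 1)" r] lip[of r "real (x + y + 1)"] r bottom at' rim xy dist_sym by auto
    then have "dist p (vertex_point (b (Suc k))) + 1 \<le> D \<or> dist p (vertex_point (b k)) + 1 \<le> D"
      using D(3) xy by auto
    then show ?thesis using near by blast
  next
    case inner
    then have "p = edge_point (a (Suc k)) (b (Suc k)) (r - x)"
      using rim_curve_point[OF kK, of x "r - x"] r rim xy by simp
    then have "lin_ext (chord (Suc k)) p = 0"
      using lin_ext_edge[OF arc_chord[OF k(2)]] by (simp add: chord_def)
    then have "\<forall>w\<in>points graph. lin_ext (chord (Suc k)) w = 0 \<longrightarrow> dist p w \<le> 1"
      using chord_diameter[OF k(2)] chord_zero_ends[OF k(2)] p(1) by blast
    then show ?thesis using D(1) by force
  next
    case outer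
    then have "p = edge_point (b k) (a k) (r - (x + y + 1))"
      using rim_curve_point[OF kK, of "x + y + 1" "r - (x + y + 1)"] r rim xy by simp
    then have "lin_ext (chord k) p = 0"
      using lin_ext_edge[OF arcs_sym[OF arc_chord[OF kK]]] by (simp add: chord_def)
    then have "\<forall>w\<in>points graph. lin_ext (chord k) w = 0 \<longrightarrow> dist p w \<le> 1"
      using chord_diameter[OF kK] chord_zero_ends[OF kK] p(1) by blast
    then show ?thesis using D(1) by force
  qed
qed

lemma gate_zero_cases:
  assumes "p \<in> points graph" "lin_ext (gate i) p = 0"
  obtains (cut) "i \<le> a 0" "p = vertex_point i"
  | (chord) k where "0 < k" "k < K" "i = a 0 + k" "gate i = chord k" "ends p \<subseteq> {a k, b k}"
proof -
  consider "i \<le> a 0" | k where "0 < k" "k < K" "i = a 0 + k" | "a 0 + K \<le> i"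
    by (metis add.right_neutral le_add_diff_inverse linorder_not_le nat_add_left_cancel_less nat_le_linear)
  then show thesis
  proof cases
    case 1
    then show ?thesis using cut cut_zero[OF 1 assms(1)] assms(2) by (simp add: gate_def)
  next
    case (2 k)
    then show ?thesis using chord[OF 2] gate_chord[OF 2(1,2)] chord_zero_ends[OF 2(2) assms(1)] assms(2)
      by simp
  next
    case 3
    then have "gate i = (\<lambda>_. -1)" using K by (auto simp: gate_def)
    then show ?thesis using ternary_zero_iff[OF ternary_gate assms(1), of i] assms(2)
        ends_nonempty[OF assms(1)] by auto
  qed
qed

text \<open>\<open>cells\<close> says that half of len k / 2 + 1 is at most \<open>D\<close>, where
  len k / 2 bounds the diameter of the cell and 1 that of a chord. For the cells between two chord
  gates, \<open>inner\<close> provides the hypotheses of \<open>inner_cell_near\<close>.\<close>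

lemma ladder_hyperbolicity:
  assumes cells: "\<And>k. k < K \<Longrightarrow> real (len k) + 2 \<le> 4 * D"
    and inner: "\<And>k. 0 < k \<Longrightarrow> Suc k < K \<Longrightarrow>
      real (a (Suc k) - a k) + 2 \<le> 2 * D \<and> real (b k - b (Suc k)) + 2 \<le> 2 * D"
  shows "hyperbolicity graph \<le> D"
proof -
  have "real g \<le> real (len 0)" using g_le[of 0] K unfolding len_def by (simp only: of_nat_le_iff)
  \<comment> \<open>A cell has at least 5 edges, so 4 D \<ge> 7. The bound takes care of the tail
    cells, which are single edges, and of points on a chord.\<close>
  then have D1: "1 \<le> D" using cells[of 0] g5 K by simp
  interpret gated_graph graph gate "a 0 + K" gate_size cell_size D
  proof
    fix i p q r
    show "lipschitz1 (gate i)" using ternary_gate by (simp add: ternary_def)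
    show "0 \<le> gate_size i" by (simp add: gate_size_def)
    show "0 \<le> lin_ext (gate 0) p" if "p \<in> points graph"
    proof -
      have "0 \<le> gate 0 u" for u by (simp add: gate_def cut_def)
      then show ?thesis using ternary_nonneg_iff[OF ternary_gate that] by blast
    qed
    show "lin_ext (gate (a 0 + K)) p < 0" if "p \<in> points graph"
      using ternary_nonneg_iff[OF ternary_gate that, of "a 0 + K"] ends_nonempty[OF that] K
      by (auto simp: gate_def not_le[symmetric])
    show "0 < lin_ext (gate i) p"
      if "i < a 0 + K" "p \<in> points graph" "0 \<le> lin_ext (gate (Suc i)) p"
    proof -
      have "\<forall>u\<in>ends p. 0 < gate i u"
        using that(3) ternary_nonneg_iff[OF ternary_gate that(2)] gate_nested_vertex[OF that(1)]
          ends_verts by fastforce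
      then have "\<not> lin_ext (gate i) p \<le> 0"
        using ternary_nonpos_iff[OF ternary_gate that(2)] ends_nonempty[OF that(2)] by fastforce
      then show ?thesis by simp
    qed
    show "dist p q \<le> gate_size i"
      if "p \<in> points graph" "q \<in> points graph" "lin_ext (gate i) p = 0" "lin_ext (gate i) q = 0"
      using that(1,3)
    proof (cases rule: gate_zero_cases)
      case cut
      have "q = vertex_point i" using that(2,4) by (cases rule: gate_zero_cases) (use cut in auto)
      then show ?thesis using cut dist_self[OF that(1)] by (simp add: gate_size_def)
    next
      case (chord k)
      have "ends q \<subseteq> {a k, b k}" using that(2,4) by (cases rule: gate_zero_cases) (use chord in auto)
      then show ?thesis using chord chord_diameter that by (simp add: gate_size_def)
    qed
    show "lin_ext (gate i) q = 0"
      if pts: "p \<in> points graph" "q \<in> points graph" "r \<in> points graph"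
        and z: "lin_ext (gate i) p = 0" "lin_ext (gate i) r = 0"
        and between: "dist p q + dist q r = dist p r"
      using pts(1) z(1)
    proof (cases rule: gate_zero_cases)
      case cut
      have "r = p" using pts(3) z(2) by (cases rule: gate_zero_cases) (use cut in auto)
      then have "dist p q \<le> 0"
        using between dist_self[OF pts(1)] dist_nonneg[OF pts(1,2)] dist_sym[of p q] by simp
      then show ?thesis using dist_eq_0[OF pts(1,2)] z(1) by simp
    next
      case (chord k)
      have "ends r \<subseteq> {a k, b k}" using pts(3) z(2) by (cases rule: gate_zero_cases) (use chord in auto)
      have "ends q \<subseteq> {a k, b k}"
        by (rule edge_convex[OF arc_chord[OF chord(2)] _ pts chord(5) \<open>ends r \<subseteq> _\<close> between])
          (rule chord_no_triangle[OF chord(2)])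
      then have "\<forall>u\<in>ends q. gate i u = 0" using chord(4) by (auto simp: chord_def)
      then show ?thesis using ternary_zero_iff[OF ternary_gate pts(2)] by blast
    qed
    show "dist p q \<le> cell_size i"
      if i: "i < a 0 + K" and pts: "p \<in> points graph" "q \<in> points graph"
        and p: "0 \<le> lin_ext (gate i) p" "lin_ext (gate (Suc i)) p \<le> 0"
        and q: "0 \<le> lin_ext (gate i) q" "lin_ext (gate (Suc i)) q \<le> 0"
    proof (cases "i < a 0")
      case True
      have tail: "ends p \<subseteq> {i, Suc i}"
        if "p \<in> points graph" "0 \<le> lin_ext (gate i) p" "lin_ext (gate (Suc i)) p \<le> 0" for p
      proof
        fix u assume "u \<in> ends p"
        then have "0 \<le> gate i u" "gate (Suc i) u \<le> 0"
          using that(2,3) ternary_nonneg_iff[OF ternary_gate that(1)]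
            ternary_nonpos_iff[OF ternary_gate that(1)] by blast+
        then have "0 \<le> cut i u" "cut (Suc i) u \<le> 0" using True by (simp_all add: gate_def)
        then show "u \<in> {i, Suc i}" by (auto simp: cut_def split: if_splits)
      qed
      have arc: "(i, Suc i) \<in> parcs graph" using True a_less_n[of 0] by (intro arc_Suc) auto
      obtain s t where "s \<in> {0..1}" "p = edge_point i (Suc i) s" "t \<in> {0..1}" "q = edge_point i (Suc i) t"
        using edge_point_ends_ex[OF pts(1) tail[OF pts(1) p] arc]
          edge_point_ends_ex[OF pts(2) tail[OF pts(2) q] arc] by blast
      then show ?thesis using dist_edge_le[OF arc, of s t] True by (auto simp: cell_size_def)
    next
      case False
      then obtain k where k: "i = a 0 + k" "k < K" using i by (metis le_iff_add linorder_not_le nat_add_left_cancel_less)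
      then show ?thesis
        using cell_dist[OF k(2) pts(1) cell_ends[OF k(2) pts(1)] pts(2) cell_ends[OF k(2) pts(2)]] p q
        by (simp add: cell_size_def)
    qed
    have cell_le: "cell_size i + 1 \<le> 2 * D" if "i < a 0 + K" "a 0 \<le> i"
      using cells[of "i - a 0"] that by (simp add: cell_size_def less_diff_conv2)
    show "cell_size i + gate_size i \<le> 2 * D" if "i < a 0 + K"
      using cell_le[OF that] D1 by (cases "i < a 0") (auto simp: cell_size_def gate_size_def)
    show "cell_size i + gate_size (Suc i) \<le> 2 * D" if "i < a 0 + K"
      using cell_le[OF that] D1 by (cases "i < a 0") (auto simp: cell_size_def gate_size_def)
    show "cell_size i + gate_size i + gate_size (Suc i) \<le> 2 * D \<or>
      (\<forall>p\<in>points graph. 0 \<le> lin_ext (gate i) p \<longrightarrow> lin_ext (gate (Suc i)) p \<le> 0 \<longrightarrow>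
        (\<forall>w\<in>points graph. lin_ext (gate i) w = 0 \<longrightarrow> dist p w \<le> D) \<or>
        (\<forall>w\<in>points graph. lin_ext (gate (Suc i)) w = 0 \<longrightarrow> dist p w \<le> D))"
      if i: "i < a 0 + K"
    proof (cases "a 0 < i \<and> Suc i < a 0 + K")
      case True
      then obtain k where k: "i = a 0 + k" "0 < k" "Suc k < K"
        by (metis add_Suc_right less_imp_add_positive nat_add_left_cancel_less)
      have kK: "k < K" using k by simp
      have gates: "gate i = chord k" "gate (Suc i) = chord (Suc k)"
        using k gate_chord[of k] gate_chord[of "Suc k"] by auto
      show ?thesis
      proof (rule disjI2, intro ballI impI)
        fix p assume p: "p \<in> points graph" "0 \<le> lin_ext (gate i) p" "lin_ext (gate (Suc i)) p \<le> 0"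
        have "ends p \<subseteq> cell_verts k" using cell_ends[OF kK p(1)] p k(1) by simp
        then have "(\<forall>w\<in>points graph. lin_ext (chord k) w = 0 \<longrightarrow> dist p w \<le> D) \<or>
            (\<forall>w\<in>points graph. lin_ext (chord (Suc k)) w = 0 \<longrightarrow> dist p w \<le> D)"
          using inner_cell_near[OF k(2,3) D1] inner[OF k(2,3)] p(1) by blast
        then show "(\<forall>w\<in>points graph. lin_ext (gate i) w = 0 \<longrightarrow> dist p w \<le> D) \<or>
            (\<forall>w\<in>points graph. lin_ext (gate (Suc i)) w = 0 \<longrightarrow> dist p w \<le> D)"
          by (simp only: gates)
      qed
    next
      case False
      then show ?thesis using cell_le[OF i] D1 by (cases "i < a 0") (auto simp: cell_size_def gate_size_def)
    qed
  qed
  show ?thesis by (rule gated_hyperbolicity)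
qed

end

section \<open>The extremal problem\<close>

lemma conn_graph_iff:
  "conn_graph G \<longleftrightarrow> pair_graph G \<and> Digraph_Component.connected (with_proj G)"
proof
  assume "conn_graph G"
  then interpret conn_graph G .
  have "finite (parcs G)"
    by (rule finite_subset[of _ "pverts G \<times> pverts G"]) (use arcs_verts finite_verts in auto)
  then have "pair_graph G"
    using arcs_verts arcs_sym arcs_irrefl finite_verts
    by unfold_locales (auto simp: symmetric_def sym_def)
  moreover have "Digraph_Component.connected (with_proj G)"
    unfolding connected_conv
  proof (intro conjI ballI)
    fix u v assume uv: "u \<in> verts (with_proj G)" "v \<in> verts (with_proj G)"
    then have "(u, v) \<in> (parcs G)\<^sup>*" using verts_linked by simp
    then show "(u, v) \<in> rtrancl_on (verts (with_proj G)) ((arcs_ends (with_proj G))\<^sup>s)"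
    proof (induction rule: rtrancl_induct)
      case base
      then show ?case using uv by simp
    next
      case (step v w)
      then show ?case using arcs_verts[of v w]
        by (intro rtrancl_on_into_rtrancl_on[OF step.IH]) (auto simp: symcl_def)
    qed
  qed (use verts_nonempty in simp)
  ultimately show "pair_graph G \<and> Digraph_Component.connected (with_proj G)" ..
next
  assume "pair_graph G \<and> Digraph_Component.connected (with_proj G)"
  then interpret pair_graph G by simp
  have conn: "Digraph_Component.connected (with_proj G)"
    using \<open>pair_graph G \<and> Digraph_Component.connected (with_proj G)\<close> by simp
  have sym: "(v, u) \<in> parcs G" if "(u, v) \<in> parcs G" for u v
    using that arcs_symmetric by blast
  then have symcl: "(parcs G)\<^sup>s = parcs G" by (auto simp: symcl_def)
  show "conn_graph G"
  proof
    show "(u, v) \<in> (parcs G)\<^sup>*" if "u \<in> pverts G" "v \<in> pverts G" for u v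
    proof -
      have "(u, v) \<in> rtrancl_on (pverts G) (parcs G)"
        using conn that unfolding connected_conv with_proj_simps symcl by blast
      then show ?thesis by (rule rtrancl_on_rtranclI)
    qed
    show "pverts G \<noteq> {}" using conn unfolding connected_conv by simp
  qed (use pair_finite_verts in_arcsD1 in_arcsD2 sym no_loops' in auto)
qed

lemma graph_class_iff:
  "G \<in> graph_class g c n \<longleftrightarrow>
    conn_graph G \<and> pverts G = {..<n} \<and> girth G = enat g \<and> circumference G = enat c"
  by (auto simp: graph_class_def conn_graph_iff)

text \<open>Admissibility makes \<open>graph_class\<close> nonempty, so that \<open>Min\<close> is
  an actual minimum.\<close>

lemma min_hyperbolicity_ge:
  assumes "v_admissible g c n" "5 \<le> g"
  shows "real g / 4 \<le> min_hyperbolicity g c n"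
proof -
  have "real g / 4 \<le> hyperbolicity G" if "G \<in> graph_class g c n" for G
  proof -
    from that interpret conn_graph G by (simp add: graph_class_iff)
    have girth: "girth G = enat g" using that by (simp add: graph_class_iff)
    obtain d where "is_cycle G d g" using girth_eqD(1)[OF girth] by blast
    then show ?thesis using hyperbolicity_ge[OF girth _ assms(2)] by blast
  qed
  then show ?thesis
    using assms(1) unfolding min_hyperbolicity_def v_admissible_def
    by (intro Min.boundedI finite_imageI finite_graph_class) auto
qed

lemma min_hyperbolicity_le:
  "G \<in> graph_class g c n \<Longrightarrow> hyperbolicity G \<le> D \<Longrightarrow> min_hyperbolicity g c n \<le> D"
  unfolding min_hyperbolicity_def
  using Min_le[OF finite_imageI[OF finite_graph_class], of "hyperbolicity G" hyperbolicity g c n] by auto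

text \<open>\<open>L k\<close> prescribes the length of cell \<open>k\<close>. Neighbouring cells
  share an edge, so each cell contributes L k - 2 new vertices to the Hamiltonian cycle, whence the
  formula for \<open>c\<close>. The last cell has length \<open>g\<close> and realises the
  girth.\<close>

lemma min_hyperbolicity_le_cells:
  fixes L :: "nat \<Rightarrow> nat"
  assumes K: "2 \<le> K" and g: "5 \<le> g" and L: "\<And>k. k < K \<Longrightarrow> g \<le> L k" "L (K - 1) = g"
    and c: "c = 2 + (\<Sum>k<K. L k - 2)" "c \<le> n"
    and D: "\<And>k. k < K \<Longrightarrow> real (L k) + 2 \<le> 4 * D"
      "\<And>k. 0 < k \<Longrightarrow> Suc k < K \<Longrightarrow> real ((L k - 1) div 2) + 2 \<le> 2 * D"
  shows "min_hyperbolicity g c n \<le> D"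
proof -
  \<comment> \<open>The L k - 2 edges outside the two chords are split as evenly as possible;
    \<open>y k\<close> is the longer side, so the condition on inner cells concerns it.\<close>
  define x y where "x k = (L k - 2) div 2" and "y k = (L k - 1) div 2" for k
  \<comment> \<open>The two rows of vertices approach each other from \<open>n - c\<close> and
    \<open>n - 1\<close>; the \<open>n - c\<close> vertices below form the tail.\<close>
  define a where "a k = n - c + (\<Sum>j<k. x j)" for k
  define b where "b k = n - 1 - (\<Sum>j<k. y j)" for k
  have xy: "x k + y k = L k - 2" "0 < x k" "0 < y k" "x k \<le> y k" if "k < K" for k
    using L(1)[OF that] g unfolding x_def y_def by linarith+
  have "(\<Sum>k<K. x k) + (\<Sum>k<K. y k) = (\<Sum>k<K. L k - 2)"
    using xy(1) by (simp add: sum.distrib[symmetric])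
  then have total: "(\<Sum>k<K. x k) + (\<Sum>k<K. y k) + 2 = c" using c by simp
  have ysum: "(\<Sum>j<k. y j) + y k \<le> (\<Sum>k<K. y k)" if "k < K" for k
  proof -
    have "(\<Sum>j<Suc k. y j) \<le> (\<Sum>k<K. y k)" using that by (intro sum_mono2) auto
    then show ?thesis by simp
  qed
  have steps: "a (Suc k) = a k + x k" "b k = b (Suc k) + y k" if "k < K" for k
    using ysum[OF that] total c(2) by (auto simp: a_def b_def)
  interpret ladder a b K n g
  proof
    show "b K = Suc (a K)" "n = Suc (b 0)" using total c(2) by (auto simp: a_def b_def)
    fix k assume k: "k < K"
    show "a k < a (Suc k)" "b (Suc k) < b k" "g \<le> a (Suc k) - a k + (b k - b (Suc k)) + 2"
      using steps[OF k] xy[OF k] L(1)[OF k] by auto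
  qed (use K g in auto)
  have len: "len k = L k" if "k < K" for k
    using steps[OF that] xy(1)[OF that] L(1)[OF that] g by (simp add: len_def)
  have "a 0 = n - c" by (simp add: a_def)
  then have "graph \<in> graph_class g c n"
    using girth_graph circumference_graph len[of "K - 1"] K L(2) c(2) conn_graph_axioms
    by (simp add: graph_class_iff)
  moreover have "hyperbolicity graph \<le> D"
  proof (rule ladder_hyperbolicity)
    show "real (len k) + 2 \<le> 4 * D" if "k < K" for k using D(1)[OF that] len[OF that] by simp
    show "real (a (Suc k) - a k) + 2 \<le> 2 * D \<and> real (b k - b (Suc k)) + 2 \<le> 2 * D"
      if "0 < k" "Suc k < K" for k
      using D(2)[OF that] steps[of k] xy(4)[of k] that by (simp add: y_def)
  qed
  ultimately show ?thesis by (rule min_hyperbolicity_le)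
qed

section \<open>Distribution of the surplus length over the cells\<close>

lemma bounded_summands_exist:
  fixes e m B :: nat
  assumes "e \<le> m * B"
  shows "\<exists>x. (\<forall>k. x k \<le> B) \<and> (\<Sum>k<m. x k) = e"
  using assms
proof (induction m arbitrary: e)
  case 0
  then show ?case by (intro exI[of _ "\<lambda>_. 0"]) simp
next
  case (Suc m)
  have "e - min e B \<le> m * B" using Suc.prems by auto
  from Suc.IH[OF this] obtain x where x: "\<forall>k. x k \<le> B" "(\<Sum>k<m. x k) = e - min e B" by blast
  then show ?case by (intro exI[of _ "x(m := min e B)"]) (auto simp: sum.lessThan_Suc)
qed

text \<open>There are r + 2 cells: the last keeps the length \<open>g\<close>, the other r + 1 share
  the surplus \<open>e\<close> with at most \<open>B\<close> each. For e = 0 the circumference is 2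
  + (r + 2)(g - 2) = 2g - 2 + r(g - 2). Inner cells exist only for r > 0.\<close>

lemma min_hyperbolicity_le_extra:
  assumes g: "5 \<le> g" and c: "c = 2 * g - 2 + r * (g - 2) + e" "e \<le> (r + 1) * B" "c \<le> n"
    and D: "real (g + B) + 2 \<le> 4 * D" "0 < r \<Longrightarrow> real ((g + B - 1) div 2) + 2 \<le> 2 * D"
  shows "min_hyperbolicity g c n \<le> D"
proof -
  obtain x where x: "\<forall>k. x k \<le> B" "(\<Sum>k<r + 1. x k) = e"
    using bounded_summands_exist[OF c(2)] by blast
  define L where "L k = (if k < r + 1 then g + x k else g)" for k
  have LB: "L k \<le> g + B" for k using x(1) by (simp add: L_def)
  show ?thesis
  proof (rule min_hyperbolicity_le_cells[of "r + 2" g L])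
    have "(\<Sum>k<r + 2. L k - 2) = (\<Sum>k<r + 1. L k - 2) + (g - 2)" by (simp add: L_def)
    also have "(\<Sum>k<r + 1. L k - 2) = (\<Sum>k<r + 1. (g - 2) + x k)"
      using g by (intro sum.cong) (auto simp: L_def)
    also have "\<dots> = (r + 1) * (g - 2) + e" unfolding sum.distrib x(2) by simp
    finally have "(\<Sum>k<r + 2. L k - 2) = (r + 1) * (g - 2) + e + (g - 2)" .
    moreover have "c = 2 + ((r + 1) * (g - 2) + e + (g - 2))" using c(1) g by simp
    ultimately show "c = 2 + (\<Sum>k<r + 2. L k - 2)" by simp
    show "real (L k) + 2 \<le> 4 * D" for k using D(1) LB[of k] by linarith
    show "real ((L k - 1) div 2) + 2 \<le> 2 * D" if "0 < k" "Suc k < r + 2" for k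
    proof -
      have "(L k - 1) div 2 \<le> (g + B - 1) div 2" using LB[of k] by (intro div_le_mono) simp
      then show ?thesis using D(2) that by linarith
    qed
  qed (use g c in \<open>auto simp: L_def\<close>)
qed

theorem theorem3p9:
  fixes g c n :: nat
  assumes "v_admissible g c n" and "5 \<le> g" and "g \<le> c" and "c \<le> n"
  shows "(\<forall>s::nat. 2 * g - 2 \<le> c \<and> c < 3 * g - 4 \<and> c = 2 * g - 2 + s \<and> s \<le> g - 3 \<longrightarrow>
            real g / 4 \<le> min_hyperbolicity g c n \<and>
            min_hyperbolicity g c n \<le> (real g + 2 + real s) / 4)
       \<and> (\<forall>r::nat. 0 < r \<and> even g \<and> c = 2 * g - 2 + r * (g - 2) \<longrightarrow>
            real g / 4 \<le> min_hyperbolicity g c n \<and>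
            min_hyperbolicity g c n \<le> (real g + 2) / 4)
       \<and> (\<forall>r::nat. 0 < r \<and> odd g \<and>
              2 * g - 2 + r * (g - 2) \<le> c \<and> c \<le> 2 * g - 1 + r * (g - 2) \<longrightarrow>
            real g / 4 \<le> min_hyperbolicity g c n \<and>
            min_hyperbolicity g c n \<le> (real g + 3) / 4)
       \<and> (\<forall>r s::nat. 1 \<le> r \<and> even g \<and>
              2 * g - 2 + r * (g - 2) < c \<and>
              c \<le> 2 * g - 2 + r * (g - 2) + 2 * (r + 1) * (s + 1) \<longrightarrow>
            real g / 4 \<le> min_hyperbolicity g c n \<and>
            min_hyperbolicity g c n \<le> (real g + 4 + 2 * real s) / 4)
       \<and> (\<forall>r s::nat. 1 \<le> r \<and> odd g \<and>
              2 * g - 1 + r * (g - 2) < c \<and>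
              c \<le> 2 * g - 2 + r * (g - 2) + 2 * (r + 1) * (s + 1) \<longrightarrow>
            real g / 4 \<le> min_hyperbolicity g c n \<and>
            min_hyperbolicity g c n \<le> (real g + 5 + 2 * real s) / 4)"
proof -
  note lower = min_hyperbolicity_ge[OF assms(1,2)]
  note upper = min_hyperbolicity_le_extra[OF assms(2) _ _ assms(4)]
  \<comment> \<open>Two cells, so only the bound (g + B + 2)/4 with B = s counts.\<close>
  have i: "min_hyperbolicity g c n \<le> (real g + 2 + real s) / 4" if "c = 2 * g - 2 + s" for s
    by (rule upper[of 0 s s]) (use that in auto)
  have ii: "min_hyperbolicity g c n \<le> (real g + 2) / 4"
    if "even g" "c = 2 * g - 2 + r * (g - 2)" for r
  proof (rule upper[of r 0 0])
    \<comment> \<open>For even \<open>g\<close> both sides of a cell have (g - 2)/2 edges, and the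
      bound for inner cells is (g + 2)/4 too.\<close>
    have "2 * ((g + 0 - 1) div 2) + 2 \<le> g" using that(1) assms(2) by presburger
    then have "real (2 * ((g + 0 - 1) div 2) + 2) \<le> real g" by (simp only: of_nat_le_iff)
    then show "real ((g + 0 - 1) div 2) + 2 \<le> 2 * ((real g + 2) / 4)" by simp
  qed (use that in auto)
  have iii: "min_hyperbolicity g c n \<le> (real g + 3) / 4"
    if "odd g" "2 * g - 2 + r * (g - 2) \<le> c" "c \<le> 2 * g - 1 + r * (g - 2)" for r
  \<comment> \<open>The surplus is 0 or 1, so B = 1 suffices, and the maximal length g + 1 is again
    even.\<close>
  proof (rule upper[of r "c - (2 * g - 2 + r * (g - 2))" 1])
    have "2 * ((g + 1 - 1) div 2) + 1 \<le> g" using that(1) by presburger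
    then have "real (2 * ((g + 1 - 1) div 2) + 1) \<le> real g" by (simp only: of_nat_le_iff)
    then show "real ((g + 1 - 1) div 2) + 2 \<le> 2 * ((real g + 3) / 4)" by simp
    show "c - (2 * g - 2 + r * (g - 2)) \<le> (r + 1) * 1" using that(3) by simp
  qed (use that in auto)
  have iv: "min_hyperbolicity g c n \<le> (real g + 4 + 2 * real s) / 4"
    if "even g" "2 * g - 2 + r * (g - 2) < c" "c \<le> 2 * g - 2 + r * (g - 2) + 2 * (r + 1) * (s + 1)"
    for r s
  \<comment> \<open>With B = 2(s + 1) the r + 1 cells can absorb a surplus of 2(r + 1)(s + 1). As g
    + B is even, both bounds equal (g + B + 2)/4.\<close>
  proof (rule upper[of r "c - (2 * g - 2 + r * (g - 2))" "2 * (s + 1)"])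
    have "2 * ((g + 2 * (s + 1) - 1) div 2) \<le> g + 2 * s" using that(1) assms(2) by presburger
    then have "real (2 * ((g + 2 * (s + 1) - 1) div 2)) \<le> real (g + 2 * s)"
      by (simp only: of_nat_le_iff)
    then show "real ((g + 2 * (s + 1) - 1) div 2) + 2 \<le> 2 * ((real g + 4 + 2 * real s) / 4)"
      by simp
    show "c - (2 * g - 2 + r * (g - 2)) \<le> (r + 1) * (2 * (s + 1))"
      using that(3) by (simp add: le_diff_conv ac_simps)
  qed (use that in auto)
  have v: "min_hyperbolicity g c n \<le> (real g + 5 + 2 * real s) / 4"
    if "odd g" "2 * g - 1 + r * (g - 2) < c" "c \<le> 2 * g - 2 + r * (g - 2) + 2 * (r + 1) * (s + 1)"
    for r s
  \<comment> \<open>Now g + B is odd: the longer side has (g + B - 1)/2 edges, and the bound (g + B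
    + 3)/4 for inner cells decides.\<close>
  proof (rule upper[of r "c - (2 * g - 2 + r * (g - 2))" "2 * (s + 1)"])
    have "2 * ((g + 2 * (s + 1) - 1) div 2) \<le> g + 2 * s + 1" by presburger
    then have "real (2 * ((g + 2 * (s + 1) - 1) div 2)) \<le> real (g + 2 * s + 1)"
      by (simp only: of_nat_le_iff)
    then show "real ((g + 2 * (s + 1) - 1) div 2) + 2 \<le> 2 * ((real g + 5 + 2 * real s) / 4)"
      by simp
    show "c - (2 * g - 2 + r * (g - 2)) \<le> (r + 1) * (2 * (s + 1))"
      using that(3) by (simp add: le_diff_conv ac_simps)
  qed (use that in auto)
  show ?thesis using lower i ii iii iv v by blast
qed

end
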